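(* Let $\mathbf{A}$ be an $n\times n$ Hermitian matrix and $\mathbf{b}\in\mathbb{C}^n$ a nonzero vector. Let $\mathbf{Q}_k$ be an $n\times k$ matrix (whose columns need not be orthogonal) with first column $\mathbf{b}/\|\mathbf{b}\|_2$, $\mathbf{T}_k$ a $k\times k$ real symmetric tridiagonal matrix, $\beta_k\in\mathbb{R}$, $\mathbf{q}_{k+1}\in\mathbb{C}^n$, and $\mathbf{F}_k$ an $n\times k$ matrix such that the perturbed Lanczos recurrence $$\mathbf{A}\mathbf{Q}_k=\mathbf{Q}_k\mathbf{T}_k+\beta_k\mathbf{q}_{k+1}\mathbf{e}_k^{\mathsf T}+\mathbf{F}_k$$ holds. Let $f:\mathbb{C}\to\mathbb{C}$ be analytic in a neighborhood of the eigenvalues of $\mathbf{A}$ and $\mathbf{T}_k$, let $\Gamma$ be a simple closed curve, or a union of simple closed curves, inside this neighborhood and enclosing the eigenvalues of $\mathbf{A}$ and $\mathbf{T}_k$, and let $w\in\mathbb{R}$ with $w\notin\Lambda(\mathbf{T}_k)\cup\Lambda(\mathbf{A})$. Suppose that $S_0,S_1,\dots,S_k\subset\mathbb{R}$ satisfy $\Lambda(\mathbf{A})\subset S_0$ and $\lambda_i(\mathbf{T}_k)\in S_i$ for $i=1,\dots,k$. Let $\|\cdot\|$ be the $(\mathbf{A}-w\mathbf{I})^2$-norm. Then $$\|f(\mathbf{A})\mathbf{b}-\mathsf{lan}_k(f)\|\le\left(\frac{1}{2\pi}\oint_\Gamma|f(z)|\Big(\prod_{i=1}^k\|h_{w,z}\|_{S_i}\Big)\|h_{w,z}\|_{S_0}|\mathrm{d}z|\right)\|\mathsf{err}_k(w)\|+\frac{1}{2\pi}\oint_\Gamma|f(z)|\cdot\|h_{w,z}\|_{S_0}\cdot\|\mathbf{f}_k(w,z)\|_2\,|\mathrm{d}z|,$$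 where $$\mathbf{f}_k(w,z):=\|\mathbf{b}\|_2\,\mathbf{F}_k\left((\mathbf{T}_k-z\mathbf{I})^{-1}-\det(h_{w,z}(\mathbf{T}_k))(\mathbf{T}_k-w\mathbf{I})^{-1}\right)\mathbf{e}_1 .$$
   Context: Here $\mathsf{lan}_k(f):=\|\mathbf{b}\|_2\,\mathbf{Q}_k f(\mathbf{T}_k)\mathbf{e}_1$ and $\mathsf{err}_k(w):=(\mathbf{A}-w\mathbf{I})^{-1}\mathbf{b}-\|\mathbf{b}\|_2\,\mathbf{Q}_k(\mathbf{T}_k-w\mathbf{I})^{-1}\mathbf{e}_1$, where $\mathbf{e}_1,\mathbf{e}_k$ are the first and last standard basis vectors of $\mathbb{R}^k$ (this models the output of the Lanczos algorithm in finite precision arithmetic, with $\mathbf{F}_k$ a rounding-error perturbation). For $w,z\in\mathbb{C}$, $h_{w,z}(x):=\frac{x-w}{x-z}$, and for $S\subset\mathbb{R}$, $\|h\|_S:=\sup_{x\in S}|h(x)|$ (possibly $+\infty$). $\Lambda(\mathbf{B})$ is the set of eigenvalues of $\mathbf{B}$, and $\lambda_1(\mathbf{T}_k),\dots,\lambda_k(\mathbf{T}_k)$ are the eigenvalues of $\mathbf{T}_k$. Matrix functions of Hermitian matrices are defined through the eigendecomposition. The $(\mathbf{A}-w\mathbf{I})^2$-norm is $\|\mathbf{v}\|=\sqrt{\mathbf{v}^{\mathsf H}(\mathbf{A}-w\mathbf{I})^2\mathbf{v}}=\|(\mathbf{A}-w\mathbf{I})\mathbf{v}\|_2$. "$\Gamma$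 inside the neighborhood" is meant as in the Cauchy integral formula: $\Gamma$ and the regions it bounds lie in the neighborhood where $f$ is analytic, the curves are (piecewise smooth and) such that each eigenvalue is enclosed exactly once. *)

theory Defs
  imports
    "HOL-Complex_Analysis.Complex_Analysis"
    "Jordan_Normal_Form.Spectral_Radius"
begin

text \<open>
  Vectors and matrices are those of \<^verbatim>\<open>Jordan_Normal_Form\<close>, so indices start at 0:
  the first and last basis vectors are \<open>unit_vec k 0\<close> and \<open>unit_vec k (k - 1)\<close>.
\<close>

no_notation Finite_Cartesian_Product.vec_nth (infixl \<open>$\<close> 90)
no_notation inner (infix \<open>\<bullet>\<close> 70)
hide_type (open) Finite_Cartesian_Product.vec
hide_const (open) Finite_Cartesian_Product.vec Determinants.det

abbreviation cmat :: "real mat \<Rightarrow> complex mat" where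
  "cmat M \<equiv> map_mat complex_of_real M"

definition hermitian_mat :: "complex mat \<Rightarrow> bool" where
  "hermitian_mat A \<longleftrightarrow> mat_adjoint A = A"

definition symmetric_mat :: "real mat \<Rightarrow> bool" where
  "symmetric_mat M \<longleftrightarrow> transpose_mat M = M"

definition tridiagonal_mat :: "real mat \<Rightarrow> bool" where
  "tridiagonal_mat M \<longleftrightarrow>
     (\<forall>i < dim_row M. \<forall>j < dim_col M. i + 1 < j \<or> j + 1 < i \<longrightarrow> M $$ (i, j) = 0)"

definition vnorm2 :: "complex vec \<Rightarrow> real" where
  "vnorm2 v = sqrt (Re (v \<bullet>c v))"

text \<open>\<open>mnorm M v\<close> is \<open>sqrt (v\<^sup>H M v)\<close>; note that \<open>u \<bullet>c v\<close> conjugates its second argument.\<close>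

definition mnorm :: "complex mat \<Rightarrow> complex vec \<Rightarrow> real" where
  "mnorm M v = sqrt (Re ((M *\<^sub>v v) \<bullet>c v))"

abbreviation shift_mat :: "complex mat \<Rightarrow> complex \<Rightarrow> complex mat" where
  "shift_mat M z \<equiv> M - z \<cdot>\<^sub>m 1\<^sub>m (dim_row M)"

text \<open>\<open>(M - z I)\<^sup>-\<^sup>1\<close>; unspecified if \<open>z\<close> is an eigenvalue of \<open>M\<close>.\<close>

definition resolvent :: "complex mat \<Rightarrow> complex \<Rightarrow> complex mat" where
  "resolvent M z = the (mat_inverse (shift_mat M z))"

definition eigendecomposition :: "complex mat \<Rightarrow> complex mat \<Rightarrow> (nat \<Rightarrow> complex) \<Rightarrow> bool" where
  "eigendecomposition A U d \<longleftrightarrow>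
     (let n = dim_row A in
        U \<in> carrier_mat n n \<and> U * mat_adjoint U = 1\<^sub>m n \<and> mat_adjoint U * U = 1\<^sub>m n \<and>
        A = U * mat_diag n d * mat_adjoint U)"

definition mat_fun :: "(complex \<Rightarrow> complex) \<Rightarrow> complex mat \<Rightarrow> complex mat" where
  "mat_fun f A = (THE B. \<exists>U d. eigendecomposition A U d \<and>
     B = U * mat_diag (dim_row A) (\<lambda>i. f (d i)) * mat_adjoint U)"

text \<open>The value does not depend on the choice of the eigendecomposition.\<close>

lemma mat_fun_eigendecomposition:
  assumes "eigendecomposition A U d"
  shows "mat_fun f A = U * mat_diag (dim_row A) (\<lambda>i. f (d i)) * mat_adjoint U"
proof -
  define n where "n = dim_row A"
  have adj: "mat_adjoint M \<in> carrier_mat n n" if "M \<in> carrier_mat n n" for M :: "complex mat"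
    using that by (auto simp: mat_adjoint_def)
  have dg [simp]: "mat_diag n e \<in> carrier_mat n n" for e :: "nat \<Rightarrow> complex"
    by (simp add: mat_diag_def)
  have mc [simp]: "X * Y \<in> carrier_mat n n"
    if "X \<in> carrier_mat n n" "Y \<in> carrier_mat n n" for X Y :: "complex mat"
    using that by (rule mult_carrier_mat)
  have one [simp]: "X * 1\<^sub>m n = X" if "X \<in> carrier_mat n n" for X :: "complex mat"
    using that by (rule right_mult_one_mat)
  have uniq: "V * mat_diag n (\<lambda>i. f (e i)) * mat_adjoint V
            = U * mat_diag n (\<lambda>i. f (d i)) * mat_adjoint U"
    if "eigendecomposition A V e" for V e
  proof -
    from assms have U [simp]: "U \<in> carrier_mat n n" and UU: "U * mat_adjoint U = 1\<^sub>m n"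
      "mat_adjoint U * U = 1\<^sub>m n" and AU: "A = U * mat_diag n d * mat_adjoint U"
      by (auto simp: eigendecomposition_def Let_def n_def)
    from that have V [simp]: "V \<in> carrier_mat n n" and VV: "V * mat_adjoint V = 1\<^sub>m n"
      "mat_adjoint V * V = 1\<^sub>m n" and AV: "A = V * mat_diag n e * mat_adjoint V"
      by (auto simp: eigendecomposition_def Let_def n_def)
    define U' V' where "U' = mat_adjoint U" and "V' = mat_adjoint V"
    have U' [simp]: "U' \<in> carrier_mat n n" and V' [simp]: "V' \<in> carrier_mat n n"
      using adj[OF U] adj[OF V] by (simp_all add: U'_def V'_def)
    note UU = UU[folded U'_def] and VV = VV[folded V'_def]
    define W where "W = V' * U"
    have W [simp]: "W \<in> carrier_mat n n" by (simp add: W_def)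
    have dimW [simp]: "dim_row W = n" "dim_col W = n" using carrier_matD[OF W] by simp_all
    note assoc = assoc_mult_mat[where n\<^sub>1 = n and n\<^sub>2 = n and n\<^sub>3 = n and n\<^sub>4 = n]
    have cancel: "X * (Y * Z) = Z" if "X * Y = 1\<^sub>m n" "X \<in> carrier_mat n n"
      "Y \<in> carrier_mat n n" "Z \<in> carrier_mat n n" for X Y Z :: "complex mat"
      using that by (metis assoc left_mult_one_mat)
    have "mat_diag n e * W = V' * (V * mat_diag n e * V') * U"
      by (simp add: assoc W_def cancel VV)
    also have "\<dots> = V' * (U * mat_diag n d * U') * U"
      using AU AV by (simp add: U'_def V'_def)
    also have "\<dots> = W * mat_diag n d"
      by (simp add: assoc W_def cancel UU)
    finally have eq: "mat_diag n e * W = W * mat_diag n d" .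
    have ent: "e i * W $$ (i, j) = W $$ (i, j) * d j" if "i < n" "j < n" for i j
    proof -
      have "(mat_diag n e * W) $$ (i, j) = e i * W $$ (i, j)"
        using that by (subst mat_diag_mult_left[OF W]) simp
      moreover have "(W * mat_diag n d) $$ (i, j) = W $$ (i, j) * d j"
        using that by (subst mat_diag_mult_right[OF W]) simp
      ultimately show ?thesis using eq by metis
    qed
    have eqf: "mat_diag n (\<lambda>i. f (e i)) * W = W * mat_diag n (\<lambda>i. f (d i))"
    proof (rule eq_matI)
      fix i j assume "i < dim_row (W * mat_diag n (\<lambda>i. f (d i)))"
        "j < dim_col (W * mat_diag n (\<lambda>i. f (d i)))"
      then have ij: "i < n" "j < n" using W dg[of "\<lambda>i. f (d i)"] by auto
      have "f (e i) * W $$ (i, j) = W $$ (i, j) * f (d j)"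
        using ent[OF ij] by (cases "W $$ (i, j) = 0") auto
      then show "(mat_diag n (\<lambda>i. f (e i)) * W) $$ (i, j) = (W * mat_diag n (\<lambda>i. f (d i))) $$ (i, j)"
        using ij by (subst mat_diag_mult_left[OF W], subst mat_diag_mult_right[OF W]) simp
    qed (use W in \<open>auto simp: mat_diag_def\<close>)
    have VW: "V * W = U" "W * U' = V'"
      by (simp_all add: W_def assoc cancel UU VV)
    have "V * mat_diag n (\<lambda>i. f (e i)) * V' = V * (mat_diag n (\<lambda>i. f (e i)) * W) * U'"
      by (simp add: assoc VW)
    also have "\<dots> = V * (W * mat_diag n (\<lambda>i. f (d i))) * U'"
      by (simp only: eqf)
    also have "\<dots> = (V * W) * mat_diag n (\<lambda>i. f (d i)) * U'"
      by (simp add: assoc)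
    finally show ?thesis
      by (simp add: VW U'_def V'_def)
  qed
  show ?thesis
    unfolding mat_fun_def n_def[symmetric] by (rule the_equality) (use assms uniq in blast)+
qed

definition hfun :: "complex \<Rightarrow> complex \<Rightarrow> complex \<Rightarrow> complex" where
  "hfun w z x = (x - w) / (x - z)"

text \<open>
  The supremum of \<open>|h\<^sub>w\<^sub>,\<^sub>z|\<close> over \<open>S\<close>, as an extended real. HOL's \<open>a / 0 = 0\<close> would hide the pole
  at \<open>x = z\<close>, so the value there is set to \<open>\<infinity>\<close>. For \<open>z = w\<close> there is no pole.
\<close>

definition hnorm :: "complex \<Rightarrow> complex \<Rightarrow> real set \<Rightarrow> ennreal" where
  "hnorm w z S = (SUP x\<in>S. if complex_of_real x = z \<and> z \<noteq> w then \<infinity>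
                            else ennreal (cmod (hfun w z (complex_of_real x))))"

definition lan ::
    "complex mat \<Rightarrow> real mat \<Rightarrow> complex vec \<Rightarrow> (complex \<Rightarrow> complex) \<Rightarrow> complex vec" where
  "lan Q T b f =
     complex_of_real (vnorm2 b) \<cdot>\<^sub>v (Q *\<^sub>v (mat_fun f (cmat T) *\<^sub>v unit_vec (dim_row T) 0))"

definition err ::
    "complex mat \<Rightarrow> complex mat \<Rightarrow> real mat \<Rightarrow> complex vec \<Rightarrow> complex \<Rightarrow> complex vec" where
  "err A Q T b w = resolvent A w *\<^sub>v b
     - complex_of_real (vnorm2 b) \<cdot>\<^sub>v (Q *\<^sub>v (resolvent (cmat T) w *\<^sub>v unit_vec (dim_row T) 0))"

definition pert ::
    "complex mat \<Rightarrow> real mat \<Rightarrow> complex vec \<Rightarrow> complex \<Rightarrow> complex \<Rightarrow> complex vec" where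
  "pert F T b w z = complex_of_real (vnorm2 b) \<cdot>\<^sub>v
     (F *\<^sub>v ((resolvent (cmat T) z
               - det (mat_fun (hfun w z) (cmat T)) \<cdot>\<^sub>m resolvent (cmat T) w)
             *\<^sub>v unit_vec (dim_row T) 0))"

text \<open>The arc length integral \<open>\<integral>\<^sub>\<Gamma> g(z) |dz|\<close> over a finite union \<open>\<Gamma>\<close> of parametrised curves.\<close>

definition arc_integral :: "(real \<Rightarrow> complex) set \<Rightarrow> (complex \<Rightarrow> ennreal) \<Rightarrow> ennreal" where
  "arc_integral \<Gamma> g = (\<Sum>\<gamma>\<in>\<Gamma>. \<integral>\<^sup>+t\<in>{0..1}.
     g (\<gamma> t) * ennreal (cmod (vector_derivative \<gamma> (at t within {0..1}))) \<partial>lborel)"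

end

theory Submission
  imports Defs
begin

text \<open>
  Write \<open>R\<^sub>z = (A - z I)\<^sup>-\<^sup>1\<close>. Multiplying the recurrence by \<open>(T - z I)\<^sup>-\<^sup>1 e\<^sub>1\<close> expresses the residual
  \<open>(A - z I) err(z)\<close> through the corner entry \<open>e\<^sub>k\<^sup>T (T - z I)\<^sup>-\<^sup>1 e\<^sub>1\<close> and a term with \<open>F\<close>. As \<open>T\<close> is
  tridiagonal, the corner entry times \<open>det (T - z I)\<close> does not depend on \<open>z\<close> (Cramer's rule), so
  \<open>(A - z I) err(z) = det (h(T)) (A - w I) err(w) - f\<^sub>k(w, z)\<close>, and multiplication by
  \<open>(A - w I) R\<^sub>z = h(A)\<close> bounds \<open>err(z)\<close> in the \<open>(A - w I)\<^sup>2\<close>-norm. Finally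
  \<open>f(A) b - lan(f)\<close> is minus the Cauchy integral of \<open>f(z) err(z)\<close>.

  The vector integral is tested against a unit vector \<open>v\<close>, which turns it into scalar contour
  integrals of rational functions times \<open>f\<close>. The two terms of the bound are separated, and the
  factor \<open>err(w)\<close> extracted, in the contour integrals: the integrands with \<open>hnorm\<close> on the
  right-hand side are never shown to be measurable, so their integrals could not be split.
\<close>

section \<open>Spectral theorem for Hermitian matrices\<close>

lemma mat_adjoint_dim [simp]:
  "dim_row (mat_adjoint A) = dim_col A" "dim_col (mat_adjoint A) = dim_row A"
  by (simp_all add: mat_adjoint_def)

lemma mat_adjoint_carrier [simp]:
  "A \<in> carrier_mat n m \<Longrightarrow> mat_adjoint A \<in> carrier_mat m n"
  by auto

lemma mat_adjoint_index [simp]: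
  fixes A :: "complex mat"
  assumes "i < dim_col A" "j < dim_row A"
  shows "mat_adjoint A $$ (i, j) = cnj (A $$ (j, i))"
  using assms by (simp add: mat_adjoint_def mat_of_rows_index)

lemma mat_adjoint_mult:
  fixes A B :: "complex mat"
  assumes "A \<in> carrier_mat n m" "B \<in> carrier_mat m l"
  shows "mat_adjoint (A * B) = mat_adjoint B * mat_adjoint A"
  using assms by (intro eq_matI) (auto simp: scalar_prod_def mult.commute)

lemma mat_adjoint_adjoint [simp]: "mat_adjoint (mat_adjoint A) = (A :: complex mat)"
  by (intro eq_matI) auto

lemma cscalar_prod_adjoint:
  fixes A :: "complex mat"
  assumes "A \<in> carrier_mat n m" "u \<in> carrier_vec m" "v \<in> carrier_vec n"
  shows "(A *\<^sub>v u) \<bullet>c v = u \<bullet>c (mat_adjoint A *\<^sub>v v)"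
proof -
  have "(A *\<^sub>v u) \<bullet>c v = (\<Sum>i<n. \<Sum>j<m. A $$ (i, j) * u $ j * cnj (v $ i))"
    using assms by (simp add: scalar_prod_def atLeast0LessThan sum_distrib_right)
  also have "\<dots> = (\<Sum>j<m. \<Sum>i<n. A $$ (i, j) * u $ j * cnj (v $ i))"
    by (rule sum.swap)
  also have "\<dots> = u \<bullet>c (mat_adjoint A *\<^sub>v v)"
    using assms by (simp add: scalar_prod_def atLeast0LessThan sum_distrib_left mult_ac)
  finally show ?thesis .
qed

lemma cscalar_prod_self:
  assumes "v \<in> carrier_vec n"
  shows "v \<bullet>c v = complex_of_real (\<Sum>i<n. (cmod (v $ i))\<^sup>2)"
  using assms
  by (simp add: scalar_prod_def atLeast0LessThan complex_norm_square[symmetric] flip: of_real_power)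

text \<open>Makes the inequalities for \<open>L2_set\<close> available: Cauchy-Schwarz and the bound
  for diagonal matrices are taken from there.\<close>

lemma vnorm2_L2_set:
  assumes "v \<in> carrier_vec n"
  shows "vnorm2 v = L2_set (\<lambda>i. cmod (v $ i)) {..<n}"
  using assms by (simp add: vnorm2_def L2_set_def cscalar_prod_self[OF assms])

lemma cscalar_prod_self_vnorm2:
  assumes "v \<in> carrier_vec n"
  shows "v \<bullet>c v = complex_of_real ((vnorm2 v)\<^sup>2)"
  using assms by (simp add: vnorm2_L2_set[OF assms] L2_set_def cscalar_prod_self[OF assms] sum_nonneg)

lemma vnorm2_nonneg: "v \<in> carrier_vec n \<Longrightarrow> vnorm2 v \<ge> 0"
  by (simp add: vnorm2_L2_set L2_set_nonneg)

lemma vnorm2_eq_0_iff: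
  assumes "v \<in> carrier_vec n"
  shows "vnorm2 v = 0 \<longleftrightarrow> v = 0\<^sub>v n"
  using cscalar_prod_self_vnorm2[OF assms] conjugate_square_eq_0_vec[OF assms] by auto

lemma vnorm2_smult: "v \<in> carrier_vec n \<Longrightarrow> vnorm2 (c \<cdot>\<^sub>v v) = cmod c * vnorm2 v"
  by (auto simp: vnorm2_L2_set[of _ n] L2_set_right_distrib norm_mult intro!: L2_set_cong)

lemma cscalar_prod_Cauchy_Schwarz:
  assumes u: "u \<in> carrier_vec n" and v: "v \<in> carrier_vec n"
  shows "cmod (u \<bullet>c v) \<le> vnorm2 u * vnorm2 v"
proof -
  have "cmod (u \<bullet>c v) \<le> (\<Sum>i<n. \<bar>cmod (u $ i)\<bar> * \<bar>cmod (v $ i)\<bar>)"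
    using u v unfolding scalar_prod_def
    by (auto simp: atLeast0LessThan norm_mult intro!: order_trans[OF norm_sum])
  also have "\<dots> \<le> vnorm2 u * vnorm2 v"
    unfolding vnorm2_L2_set[OF u] vnorm2_L2_set[OF v] by (rule L2_set_mult_ineq)
  finally show ?thesis .
qed

lemma vnorm2_isometry:
  assumes U: "U \<in> carrier_mat m n" and UU: "mat_adjoint U * U = 1\<^sub>m n" and v: "v \<in> carrier_vec n"
  shows "vnorm2 (U *\<^sub>v v) = vnorm2 v"
proof -
  have "(U *\<^sub>v v) \<bullet>c (U *\<^sub>v v) = v \<bullet>c (mat_adjoint U *\<^sub>v (U *\<^sub>v v))"
    using U v by (intro cscalar_prod_adjoint) auto
  also have "mat_adjoint U *\<^sub>v (U *\<^sub>v v) = (mat_adjoint U * U) *\<^sub>v v"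
    using U v by (subst assoc_mult_mat_vec) auto
  also have "\<dots> = v" using v by (simp add: UU)
  finally show ?thesis by (simp add: vnorm2_def)
qed

lemma mult_mat_diag_vec:
  assumes "v \<in> carrier_vec n"
  shows "mat_diag n d *\<^sub>v v = vec n (\<lambda>i. d i * v $ i)"
proof (rule eq_vecI)
  fix i assume i: "i < dim_vec (vec n (\<lambda>i. d i * v $ i))"
  then have "(mat_diag n d *\<^sub>v v) $ i = (\<Sum>j<n. if i = j then d j * v $ j else 0)"
    using assms
    by (simp add: mat_diag_def scalar_prod_def atLeast0LessThan if_distrib[of "\<lambda>x. x * _"] cong: if_cong)
  then show "(mat_diag n d *\<^sub>v v) $ i = vec n (\<lambda>i. d i * v $ i) $ i"
    using i by simp
qed (simp add: mat_diag_def)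

lemma vnorm2_mat_diag_le:
  assumes v: "v \<in> carrier_vec n" and M: "\<And>i. i < n \<Longrightarrow> cmod (d i) \<le> M" and M0: "M \<ge> 0"
  shows "vnorm2 (mat_diag n d *\<^sub>v v) \<le> M * vnorm2 v"
proof -
  have "vnorm2 (mat_diag n d *\<^sub>v v) = L2_set (\<lambda>i. cmod (d i * v $ i)) {..<n}"
    using v by (subst vnorm2_L2_set[of _ n]) (auto simp: mult_mat_diag_vec intro!: L2_set_cong)
  also have "\<dots> \<le> L2_set (\<lambda>i. M * cmod (v $ i)) {..<n}"
    by (intro L2_set_mono) (auto simp: norm_mult intro!: mult_right_mono M)
  also have "\<dots> = M * vnorm2 v"
    using M0 by (simp add: vnorm2_L2_set[OF v] L2_set_right_distrib)
  finally show ?thesis .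
qed

text \<open>Complete \<open>v\<close> to a basis and apply Gram-Schmidt. That process keeps the
  first vector and only orthogonalizes, so the columns are divided by their norms \<open>r j\<close>
  afterwards.\<close>

lemma unitary_with_first_column:
  fixes v :: "complex vec"
  assumes v: "v \<in> carrier_vec n" and v0: "v \<noteq> 0\<^sub>v n" and n: "n > 0"
  obtains V where "V \<in> carrier_mat n n" "mat_adjoint V * V = 1\<^sub>m n" "V * mat_adjoint V = 1\<^sub>m n"
    "col V 0 = complex_of_real (1 / vnorm2 v) \<cdot>\<^sub>v v"
proof -
  interpret cof_vec_space n "TYPE(complex)" .
  define b where "b = basis_completion v"
  define ws where "ws = gram_schmidt n b"
  from basis_completion[OF v v0, folded b_def]
  have dist_b: "distinct b" and indep: "\<not> lin_dep (set b)" and b: "set b \<subseteq> carrier_vec n"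
    and hdb: "hd b = v" and len_b: "length b = n" by auto
  from hdb len_b n obtain vs where bv: "b = v # vs" by (cases b) auto
  from gram_schmidt_result[OF b dist_b indep refl, folded ws_def]
  have ws: "set ws \<subseteq> carrier_vec n" "corthogonal ws" "length ws = n"
    by (auto simp: len_b)
  from gram_schmidt_hd[OF v, of vs, folded bv] have hdws: "hd ws = v" unfolding ws_def .
  have wsc: "ws ! i \<in> carrier_vec n" if "i < n" for i using ws that by auto
  have ws0: "ws ! 0 = v" using hdws ws n by (metis hd_conv_nth length_0_conv not_less_zero)
  define r where "r i = vnorm2 (ws ! i)" for i
  define V where "V = mat n n (\<lambda>(i, j). ws ! j $ i / complex_of_real (r j))"
  have V: "V \<in> carrier_mat n n" by (simp add: V_def)
  have VV: "mat_adjoint V * V = 1\<^sub>m n"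
  proof (rule eq_matI)
    fix i j assume "i < dim_row (1\<^sub>m n :: complex mat)" "j < dim_col (1\<^sub>m n :: complex mat)"
    then have i: "i < n" and j: "j < n" by auto
    have "(mat_adjoint V * V) $$ (i, j) = (\<Sum>l<n. (ws ! j $ l * cnj (ws ! i $ l)) / complex_of_real (r i * r j))"
      using i j V by (auto simp: scalar_prod_def V_def atLeast0LessThan intro!: sum.cong)
    also have "\<dots> = (ws ! j \<bullet>c ws ! i) / complex_of_real (r i * r j)"
      using wsc[OF i] by (simp add: scalar_prod_def atLeast0LessThan sum_divide_distrib)
    also have "\<dots> = (if i = j then 1 else 0)"
    proof (cases "i = j")
      case True
      have "ws ! i \<bullet>c ws ! i \<noteq> 0" using corthogonalD[OF ws(2)] i ws(3) by auto
      then show ?thesis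
        using True cscalar_prod_self_vnorm2[OF wsc[OF i]] by (simp add: r_def power2_eq_square)
    next
      case False
      then show ?thesis using corthogonalD[OF ws(2), of j i] i j ws(3) by simp
    qed
    finally show "(mat_adjoint V * V) $$ (i, j) = 1\<^sub>m n $$ (i, j)" using i j by simp
  qed (use V in auto)
  have "V * mat_adjoint V = 1\<^sub>m n"
    using mat_mult_left_right_inverse[OF mat_adjoint_carrier[OF V] V VV] .
  moreover have "col V 0 = complex_of_real (1 / vnorm2 v) \<cdot>\<^sub>v v"
    using n v by (intro eq_vecI) (auto simp: V_def r_def ws0)
  ultimately show thesis using that V VV by blast
qed

lemma mat_adjoint_four_block_diag:
  fixes A D :: "complex mat"
  assumes "A \<in> carrier_mat n n" "D \<in> carrier_mat m m"
  shows "mat_adjoint (four_block_mat A (0\<^sub>m n m) (0\<^sub>m m n) D)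
       = four_block_mat (mat_adjoint A) (0\<^sub>m n m) (0\<^sub>m m n) (mat_adjoint D)"
  using assms by (intro eq_matI) auto

lemma mult_four_block_diag:
  fixes A B D E :: "complex mat"
  assumes "A \<in> carrier_mat n n" "D \<in> carrier_mat m m" "B \<in> carrier_mat n n" "E \<in> carrier_mat m m"
  shows "four_block_mat A (0\<^sub>m n m) (0\<^sub>m m n) D * four_block_mat B (0\<^sub>m n m) (0\<^sub>m m n) E
       = four_block_mat (A * B) (0\<^sub>m n m) (0\<^sub>m m n) (D * E)"
  using assms by (subst mult_four_block_mat) auto

text \<open>Deflation: a unitary \<open>V\<close> whose first column is a normalized eigenvector
  conjugates \<open>A\<close> to a Hermitian \<open>B\<close> that splits into the 1 by 1 block
  \<open>e\<close> and a smaller Hermitian block, to which the induction hypothesis applies.\<close>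

theorem hermitian_eigendecomposition:
  assumes "A \<in> carrier_mat n n" "hermitian_mat A"
  shows "\<exists>U d. eigendecomposition A U d"
  using assms
proof (induction n arbitrary: A)
  case 0
  then have "eigendecomposition A (1\<^sub>m 0) (\<lambda>_. 0)"
    by (auto simp: eigendecomposition_def Let_def)
  then show ?case by blast
next
  case (Suc m)
  let ?n = "Suc m"
  note A = Suc.prems(1)
  have herm: "mat_adjoint A = A" using Suc.prems(2) by (simp add: hermitian_mat_def)
  have "spectrum A \<noteq> {}" using A by (intro spectrum_non_empty) auto
  then obtain e where "eigenvalue A e" by (auto simp: spectrum_def)
  then obtain v where v: "v \<in> carrier_vec ?n" "v \<noteq> 0\<^sub>v ?n" and Av: "A *\<^sub>v v = e \<cdot>\<^sub>v v"
    using A by (auto simp: eigenvalue_def eigenvector_def)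
  obtain V where V: "V \<in> carrier_mat ?n ?n" and VV: "mat_adjoint V * V = 1\<^sub>m ?n" "V * mat_adjoint V = 1\<^sub>m ?n"
    and V0: "col V 0 = complex_of_real (1 / vnorm2 v) \<cdot>\<^sub>v v"
    using unitary_with_first_column[OF v] by blast
  define V' where "V' = mat_adjoint V"
  have V': "V' \<in> carrier_mat ?n ?n" using V by (simp add: V'_def)
  note VV = VV[folded V'_def]
  define B where "B = V' * A * V"
  have B: "B \<in> carrier_mat ?n ?n" using V V' A by (simp add: B_def)
  note assoc = assoc_mult_mat[where n\<^sub>1 = ?n and n\<^sub>2 = ?n and n\<^sub>3 = ?n and n\<^sub>4 = ?n]
  have cancel: "X * (Y * Z) = Z" if "X * Y = 1\<^sub>m ?n" "X \<in> carrier_mat ?n ?n"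
    "Y \<in> carrier_mat ?n ?n" "Z \<in> carrier_mat ?n ?n" for X Y Z :: "complex mat"
    using that by (metis assoc left_mult_one_mat)
  note mc = mult_carrier_mat[where nr = ?n and n = ?n and nc = ?n]
  have B_adj: "mat_adjoint B = B"
    using A V V' by (simp add: B_def mat_adjoint_mult[of _ ?n ?n _ ?n] herm assoc mc V'_def)
  have AVB: "A = V * B * V'"
    using A V V' B by (simp add: B_def assoc mc cancel VV)
  have colB: "col B 0 = e \<cdot>\<^sub>v unit_vec ?n 0"
  proof -
    have "col B 0 = (V' * A) *\<^sub>v col V 0" using A V V' by (simp add: B_def col_mult2[of _ ?n ?n _ ?n] del: assoc_mult_mat)
    also have "\<dots> = V' *\<^sub>v (A *\<^sub>v col V 0)"
      using A V V' by (intro assoc_mult_mat_vec) (auto intro!: col_carrier_vec)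
    also have "A *\<^sub>v col V 0 = e \<cdot>\<^sub>v col V 0"
      using A v by (simp add: V0 Av mult_mat_vec[OF A] smult_smult_assoc mult.commute)
    also have "V' *\<^sub>v \<dots> = e \<cdot>\<^sub>v (V' *\<^sub>v col V 0)"
      using V V' by (intro mult_mat_vec) (auto intro!: col_carrier_vec)
    also have "V' *\<^sub>v col V 0 = col (V' * V) 0" by (rule col_mult2[OF V' V, symmetric]) simp
    also have "\<dots> = unit_vec ?n 0" by (simp add: VV)
    finally show ?thesis .
  qed
  have B_i0: "B $$ (i, 0) = (if i = 0 then e else 0)" if "i < ?n" for i
  proof -
    have "B $$ (i, 0) = col B 0 $ i" using that B by simp
    then show ?thesis unfolding colB using that by (simp add: unit_vec_def)
  qed
  have B_sym: "B $$ (i, j) = cnj (B $$ (j, i))" if "i < ?n" "j < ?n" for i j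
    using that B mat_adjoint_index[of i B j] B_adj by simp
  \<comment> \<open>The eigenvector clears the first column only; the first row vanishes because
    \<open>B\<close> is Hermitian.\<close>
  have B_0j: "B $$ (0, j) = 0" if "0 < j" "j < ?n" for j
    using B_sym[of 0 j] B_i0[of j] that by simp
  define B' where "B' = mat m m (\<lambda>(i, j). B $$ (Suc i, Suc j))"
  have B': "B' \<in> carrier_mat m m" by (simp add: B'_def)
  define E where "E = mat 1 1 (\<lambda>_. e)"
  have E: "E \<in> carrier_mat 1 1" by (simp add: E_def)
  have "hermitian_mat B'"
    unfolding hermitian_mat_def
    by (intro eq_matI) (auto simp: B'_def B_sym[symmetric])
  then obtain U' d' where "eigendecomposition B' U' d'" using Suc.IH[OF B'] by blast
  then have U': "U' \<in> carrier_mat m m" and UU': "U' * mat_adjoint U' = 1\<^sub>m m" "mat_adjoint U' * U' = 1\<^sub>m m"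
    and BU': "B' = U' * mat_diag m d' * mat_adjoint U'"
    using B' by (auto simp: eigendecomposition_def Let_def)
  let ?blk = "\<lambda>X Y. four_block_mat X (0\<^sub>m 1 m) (0\<^sub>m m 1) Y"
  define W where "W = ?blk (1\<^sub>m 1) U'"
  define W' where "W' = mat_adjoint W"
  have one_adj: "mat_adjoint (1\<^sub>m l) = (1\<^sub>m l :: complex mat)" for l
    by (intro eq_matI) auto
  have W: "W \<in> carrier_mat ?n ?n" using U' by (auto simp: W_def)
  have W': "W' \<in> carrier_mat ?n ?n" using W by (simp add: W'_def)
  have W'_eq: "W' = ?blk (1\<^sub>m 1) (mat_adjoint U')"
    using U' by (simp add: W'_def W_def mat_adjoint_four_block_diag one_adj)
  have WW: "W * W' = 1\<^sub>m ?n" "W' * W = 1\<^sub>m ?n"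
    using U' by (simp_all add: W'_eq W_def mult_four_block_diag UU')
  \<comment> \<open>The new eigenvalue takes index 0 and those of \<open>B'\<close> move up by one,
    in line with the blocks of \<open>W\<close>.\<close>
  define d where "d = case_nat e d'"
  have D: "mat_diag ?n d = ?blk E (mat_diag m d')"
    by (intro eq_matI) (auto simp: mat_diag_def d_def E_def split: nat.split)
  have "B = ?blk E B'"
    using B by (intro eq_matI)
      (auto simp: B'_def E_def B_i0 B_0j less_Suc_eq_0_disj)
  also have "\<dots> = W * mat_diag ?n d * W'"
    using U' E unfolding D W'_eq W_def
    by (simp add: mult_four_block_diag BU')
  finally have BW: "B = W * mat_diag ?n d * W'" .
  define U where "U = V * W"
  have U: "U \<in> carrier_mat ?n ?n" using V W by (simp add: U_def)
  have U_adj: "mat_adjoint U = W' * V'"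
    using V W by (simp add: U_def W'_def V'_def mat_adjoint_mult)
  have "U * mat_adjoint U = 1\<^sub>m ?n" "mat_adjoint U * U = 1\<^sub>m ?n"
    unfolding U_adj unfolding U_def using V W V' W' by (simp_all add: assoc mc cancel WW VV)
  moreover have "A = U * mat_diag ?n d * mat_adjoint U"
    unfolding U_adj unfolding U_def AVB BW using V W V' W' by (simp add: assoc mc)
  ultimately have "eigendecomposition A U d"
    using A U by (simp add: eigendecomposition_def Let_def)
  then show ?case by blast
qed

section \<open>Contour integrals\<close>

text \<open>Contour integrals rest on the gauge integral, which does not require absolute
  integrability. If the right-hand side is infinite, nothing is to be shown. If it is finite,
  \<open>g\<close> is measurable with integrable norm, so its Lebesgue integral exists and equals
  \<open>i\<close>.\<close>

lemma norm_has_integral_le_nn_integral: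
  fixes g :: "real \<Rightarrow> complex"
  assumes g: "(g has_integral i) S" and S: "S \<in> sets lebesgue"
  shows "ennreal (norm i) \<le> (\<integral>\<^sup>+x\<in>S. ennreal (norm (g x)) \<partial>lborel)"
proof (cases "(\<integral>\<^sup>+x\<in>S. ennreal (norm (g x)) \<partial>lborel) = \<infinity>")
  case False
  let ?G = "\<lambda>x. indicator S x *\<^sub>R g x"
  \<comment> \<open>Lebesgue measure is the completion of \<open>lborel\<close>, and completing a
    measure does not change nonnegative integrals.\<close>
  have eq: "(\<integral>\<^sup>+x. ennreal (norm (?G x)) \<partial>lebesgue) = (\<integral>\<^sup>+x\<in>S. ennreal (norm (g x)) \<partial>lborel)"
    unfolding nn_integral_completion by (intro nn_integral_cong) (auto simp: indicator_def)
  have meas: "?G \<in> borel_measurable lebesgue"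
    using has_integral_implies_lebesgue_measurable[OF g] .
  have int: "integrable lebesgue ?G"
    using False by (intro integrableI_bounded meas) (simp only: eq less_top infinity_ennreal_def)
  then have "set_integrable lebesgue S g" by (simp add: set_integrable_def)
  from has_integral_unique[OF g has_integral_set_lebesgue[OF this]]
  have "i = (LINT x:S|lebesgue. g x)" .
  then show ?thesis
    using integral_norm_bound_ennreal[OF int] by (simp only: eq set_lebesgue_integral_def)
qed simp

text \<open>The nonnegative integral is monotone for arbitrary functions, so the majorant
  \<open>g\<close> may be non-measurable and may take the value \<infinity>.\<close>

lemma norm_contour_integral_le_nn_integral:
  assumes G: "(G has_contour_integral i) \<gamma>"
    and le: "\<And>z. z \<in> path_image \<gamma> \<Longrightarrow> ennreal (cmod (G z)) \<le> g z"
  shows "ennreal (cmod i) \<le> (\<integral>\<^sup>+t\<in>{0..1}.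
     g (\<gamma> t) * ennreal (cmod (vector_derivative \<gamma> (at t within {0..1}))) \<partial>lborel)"
proof -
  have "ennreal (cmod i) \<le> (\<integral>\<^sup>+t\<in>{0..1}.
     ennreal (cmod (G (\<gamma> t) * vector_derivative \<gamma> (at t within {0..1}))) \<partial>lborel)"
    using G unfolding has_contour_integral_def by (intro norm_has_integral_le_nn_integral) auto
  also have "\<dots> \<le> (\<integral>\<^sup>+t\<in>{0..1}.
     g (\<gamma> t) * ennreal (cmod (vector_derivative \<gamma> (at t within {0..1}))) \<partial>lborel)"
  proof (intro nn_integral_mono)
    fix t :: real
    show "ennreal (cmod (G (\<gamma> t) * vector_derivative \<gamma> (at t within {0..1}))) * indicator {0..1} t
      \<le> g (\<gamma> t) * ennreal (cmod (vector_derivative \<gamma> (at t within {0..1}))) * indicator {0..1} t"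
    proof (cases "t \<in> {0..1}")
      case True
      then have "\<gamma> t \<in> path_image \<gamma>" by (simp add: path_image_def)
      from mult_right_mono[OF le[OF this]] True show ?thesis by (simp add: norm_mult ennreal_mult)
    qed simp
  qed
  finally show ?thesis .
qed

text \<open>This is the homological form of the formula. Its topological condition holds because a
  point off \<open>N\<close> lies neither on the curve nor inside it, hence outside, where the
  winding number is 0.\<close>

lemma Cauchy_integral_formula_simple_loop:
  assumes "open N" "f holomorphic_on N" "\<mu> \<in> N"
    and \<gamma>: "valid_path \<gamma>" "pathfinish \<gamma> = pathstart \<gamma>"
    and sub: "path_image \<gamma> \<union> inside (path_image \<gamma>) \<subseteq> N" and \<mu>: "\<mu> \<notin> path_image \<gamma>"
  shows "((\<lambda>z. f z / (z - \<mu>)) has_contour_integral (2 * pi * \<i> * winding_number \<gamma> \<mu> * f \<mu>)) \<gamma>"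
proof (rule Cauchy_integral_formula_global[OF assms(1-3)])
  fix w assume "w \<notin> N"
  then have "w \<in> outside (path_image \<gamma>)"
    using sub unfolding outside_inside by blast
  then show "winding_number \<gamma> w = 0"
    using \<gamma> by (intro winding_number_zero_in_outside valid_path_imp_path)
qed (use \<gamma> sub \<mu> in blast)+

text \<open>The curves carry no orientation; \<open>\<epsilon>\<close> is the sign that makes the winding number positive.\<close>

lemma simple_loop_orientation:
  assumes "simple_path \<gamma>" "pathfinish \<gamma> = pathstart \<gamma>"
  obtains \<epsilon> :: complex where "cmod \<epsilon> = 1"
    "\<And>\<mu>. \<mu> \<notin> path_image \<gamma> \<Longrightarrow>
       \<epsilon> * winding_number \<gamma> \<mu> = (if \<mu> \<in> inside (path_image \<gamma>) then 1 else 0)"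
proof -
  have out: "winding_number \<gamma> \<mu> = 0"
    if "\<mu> \<notin> path_image \<gamma>" "\<mu> \<notin> inside (path_image \<gamma>)" for \<mu>
    using that assms by (intro winding_number_zero_in_outside simple_path_imp_path)
      (auto simp: outside_inside)
  show thesis
  proof (rule simple_closed_path_winding_number_inside[OF assms(1)])
    assume "\<And>z. z \<in> inside (path_image \<gamma>) \<Longrightarrow> winding_number \<gamma> z = 1"
    then show thesis using out by (intro that[of 1]) auto
  next
    assume "\<And>z. z \<in> inside (path_image \<gamma>) \<Longrightarrow> winding_number \<gamma> z = - 1"
    then show thesis using out by (intro that[of "-1"]) auto
  qed
qed

text \<open>The scalar core of the bound. By Cauchy's formula the sum of
  \<open>c j * f (m j)\<close> is, up to a factor of modulus 1/(2 pi), the integral of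
  \<open>f z\<close> times the sum of \<open>c j / (m j - z)\<close>. The latter is split by
  \<open>decomp\<close>, and linearity of the contour integral takes \<open>E\<close> out before any
  absolute values are formed. The family \<open>m\<close> may repeat values.\<close>

lemma Cauchy_integral_estimate:
  fixes f :: "complex \<Rightarrow> complex" and m c :: "'j \<Rightarrow> complex" and E :: real
  assumes N: "open N" "f holomorphic_on N" and "finite \<Gamma>"
    and curves: "\<And>\<gamma>. \<gamma> \<in> \<Gamma> \<Longrightarrow> valid_path \<gamma> \<and> simple_path \<gamma> \<and> pathfinish \<gamma> = pathstart \<gamma>"
    and sub: "\<And>\<gamma>. \<gamma> \<in> \<Gamma> \<Longrightarrow> path_image \<gamma> \<union> inside (path_image \<gamma>) \<subseteq> N"
    and avoids: "\<And>\<gamma>. \<gamma> \<in> \<Gamma> \<Longrightarrow> path_image \<gamma> \<inter> K = {}"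
    and encloses: "\<And>\<mu>. \<mu> \<in> K \<Longrightarrow> \<exists>!\<gamma>. \<gamma> \<in> \<Gamma> \<and> \<mu> \<in> inside (path_image \<gamma>)"
    and K: "finite K" "K \<subseteq> N" and J: "finite J" "\<And>j. j \<in> J \<Longrightarrow> m j \<in> K"
    and X: "X holomorphic_on (N - K)" and E: "E \<ge> 0"
    and decomp: "\<And>z. z \<in> N - K \<Longrightarrow> (\<Sum>j\<in>J. c j / (m j - z)) = of_real E * X z - Y z"
    and gX: "\<And>\<gamma> z. \<gamma> \<in> \<Gamma> \<Longrightarrow> z \<in> path_image \<gamma> \<Longrightarrow> ennreal (cmod (f z * X z)) \<le> gX z"
    and gY: "\<And>\<gamma> z. \<gamma> \<in> \<Gamma> \<Longrightarrow> z \<in> path_image \<gamma> \<Longrightarrow> ennreal (cmod (f z * Y z)) \<le> gY z"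
  shows "ennreal (cmod (\<Sum>j\<in>J. c j * f (m j)))
    \<le> (ennreal (1 / (2 * pi)) * arc_integral \<Gamma> gX) * ennreal E + ennreal (1 / (2 * pi)) * arc_integral \<Gamma> gY"
proof -
  have "\<forall>\<gamma>\<in>\<Gamma>. \<exists>\<epsilon>::complex. cmod \<epsilon> = 1 \<and> (\<forall>\<mu>. \<mu> \<notin> path_image \<gamma> \<longrightarrow>
       \<epsilon> * winding_number \<gamma> \<mu> = (if \<mu> \<in> inside (path_image \<gamma>) then 1 else 0))"
  proof
    fix \<gamma> assume "\<gamma> \<in> \<Gamma>"
    with curves have "simple_path \<gamma>" "pathfinish \<gamma> = pathstart \<gamma>" by auto
    then show "\<exists>\<epsilon>::complex. cmod \<epsilon> = 1 \<and> (\<forall>\<mu>. \<mu> \<notin> path_image \<gamma> \<longrightarrow>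
       \<epsilon> * winding_number \<gamma> \<mu> = (if \<mu> \<in> inside (path_image \<gamma>) then 1 else 0))"
      by (rule simple_loop_orientation) blast
  qed
  from bchoice[OF this] obtain \<epsilon> where all: "\<forall>\<gamma>\<in>\<Gamma>. cmod (\<epsilon> \<gamma>) = 1 \<and> (\<forall>\<mu>. \<mu> \<notin> path_image \<gamma> \<longrightarrow>
       \<epsilon> \<gamma> * winding_number \<gamma> \<mu> = (if \<mu> \<in> inside (path_image \<gamma>) then 1 else 0))" ..
  have \<epsilon>: "cmod (\<epsilon> \<gamma>) = 1" if "\<gamma> \<in> \<Gamma>" for \<gamma> using bspec[OF all that] by (rule conjunct1)
  have wn: "\<epsilon> \<gamma> * winding_number \<gamma> \<mu> = (if \<mu> \<in> inside (path_image \<gamma>) then 1 else 0)"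
    if "\<gamma> \<in> \<Gamma>" "\<mu> \<notin> path_image \<gamma>" for \<gamma> \<mu>
    using bspec[OF all that(1), THEN conjunct2] that(2) by blast
  \<comment> \<open>With the signs \<epsilon>, the whole system of curves winds exactly once around
    each point of \<open>K\<close>: the only curve enclosing it contributes 1, all others 0.\<close>
  have once: "(\<Sum>\<gamma>\<in>\<Gamma>. \<epsilon> \<gamma> * winding_number \<gamma> \<mu>) = 1" if \<mu>: "\<mu> \<in> K" for \<mu>
  proof -
    obtain \<gamma>0 where \<gamma>0: "\<gamma>0 \<in> \<Gamma>" "\<mu> \<in> inside (path_image \<gamma>0)"
      and uniq: "\<And>\<gamma>. \<gamma> \<in> \<Gamma> \<Longrightarrow> \<mu> \<in> inside (path_image \<gamma>) \<Longrightarrow> \<gamma> = \<gamma>0"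
      using encloses[OF \<mu>] unfolding Ex1_def by blast
    have "(\<Sum>\<gamma>\<in>\<Gamma>. \<epsilon> \<gamma> * winding_number \<gamma> \<mu>) = (\<Sum>\<gamma>\<in>\<Gamma>. if \<gamma> = \<gamma>0 then 1 else 0)"
    proof (intro sum.cong refl)
      fix \<gamma> assume \<gamma>: "\<gamma> \<in> \<Gamma>"
      have "\<mu> \<notin> path_image \<gamma>" using avoids[OF \<gamma>] \<mu> by blast
      moreover have "\<mu> \<in> inside (path_image \<gamma>) \<longleftrightarrow> \<gamma> = \<gamma>0" using uniq[OF \<gamma>] \<gamma>0(2) by blast
      ultimately show "\<epsilon> \<gamma> * winding_number \<gamma> \<mu> = (if \<gamma> = \<gamma>0 then 1 else 0)"
        using wn[OF \<gamma>, of \<mu>] by (simp only: simp_thms)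
    qed
    then show ?thesis using \<open>finite \<Gamma>\<close> \<gamma>0 by simp
  qed
  define R where "R z = (\<Sum>j\<in>J. c j / (m j - z))" for z
  \<comment> \<open>The minus sign comes from
    \<open>c j / (m j - z) = - (c j / (z - m j))\<close>.\<close>
  define IR where "IR \<gamma> = - 2 * pi * \<i> * (\<Sum>j\<in>J. c j * winding_number \<gamma> (m j) * f (m j))" for \<gamma>
  have IR: "((\<lambda>z. f z * R z) has_contour_integral IR \<gamma>) \<gamma>" if \<gamma>: "\<gamma> \<in> \<Gamma>" for \<gamma>
  proof -
    have "((\<lambda>z. \<Sum>j\<in>J. - c j * (f z / (z - m j))) has_contour_integral
        (\<Sum>j\<in>J. - c j * (2 * pi * \<i> * winding_number \<gamma> (m j) * f (m j)))) \<gamma>"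
      using N J K curves[OF \<gamma>] sub[OF \<gamma>] avoids[OF \<gamma>]
      by (intro has_contour_integral_sum has_contour_integral_lmul
          Cauchy_integral_formula_simple_loop) auto
    moreover have "(\<Sum>j\<in>J. - c j * (f z / (z - m j))) = f z * R z" for z
      unfolding R_def sum_distrib_left
    proof (rule sum.cong[OF refl])
      fix j
      have "c j / (m j - z) = - (c j / (z - m j))"
        by (metis minus_diff_eq minus_divide_right)
      then show "- c j * (f z / (z - m j)) = f z * (c j / (m j - z))" by simp
    qed
    moreover have "(\<Sum>j\<in>J. - c j * (2 * pi * \<i> * winding_number \<gamma> (m j) * f (m j))) = IR \<gamma>"
      by (simp add: IR_def sum_distrib_left sum_negf mult_ac)
    ultimately show ?thesis by simp
  qed
  have oNK: "open (N - K)" using N K by (simp add: open_Diff finite_imp_closed)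
  have pNK: "path_image \<gamma> \<subseteq> N - K" if "\<gamma> \<in> \<Gamma>" for \<gamma> using sub[OF that] avoids[OF that] by auto
  define IX where "IX \<gamma> = contour_integral \<gamma> (\<lambda>z. f z * X z)" for \<gamma>
  have IX: "((\<lambda>z. f z * X z) has_contour_integral IX \<gamma>) \<gamma>" if \<gamma>: "\<gamma> \<in> \<Gamma>" for \<gamma>
    unfolding IX_def
    using curves[OF \<gamma>] pNK[OF \<gamma>] oNK X N(2)
    by (intro has_contour_integral_integral contour_integrable_holomorphic_simple[of _ "N - K"])
      (auto intro!: holomorphic_on_mult intro: holomorphic_on_subset)
  \<comment> \<open>No regularity of \<open>Y\<close> is assumed: on the curve
    \<open>f z * Y z\<close> is a difference of two functions already known to be contour
    integrable.\<close>
  define IY where "IY \<gamma> = of_real E * IX \<gamma> - IR \<gamma>" for \<gamma>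
  have IY: "((\<lambda>z. f z * Y z) has_contour_integral IY \<gamma>) \<gamma>" if \<gamma>: "\<gamma> \<in> \<Gamma>" for \<gamma>
  proof -
    have "((\<lambda>z. of_real E * (f z * X z) - f z * R z) has_contour_integral IY \<gamma>) \<gamma>"
      unfolding IY_def
      by (intro has_contour_integral_diff has_contour_integral_lmul IX IR \<gamma>)
    then show ?thesis
    proof (rule has_contour_integral_eq)
      fix z assume "z \<in> path_image \<gamma>"
      then have "z \<in> N - K" using pNK[OF \<gamma>] by auto
      then have "R z = of_real E * X z - Y z" unfolding R_def by (rule decomp)
      then show "of_real E * (f z * X z) - f z * R z = f z * Y z"
        by (simp add: right_diff_distrib)
    qed
  qed
  have "(\<Sum>\<gamma>\<in>\<Gamma>. \<epsilon> \<gamma> * IR \<gamma>)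
      = (\<Sum>\<gamma>\<in>\<Gamma>. \<Sum>j\<in>J. - 2 * pi * \<i> * (c j * f (m j)) * (\<epsilon> \<gamma> * winding_number \<gamma> (m j)))"
    unfolding IR_def sum_distrib_left by (simp only: mult_ac)
  also have "\<dots> = (\<Sum>j\<in>J. - 2 * pi * \<i> * (c j * f (m j)) * (\<Sum>\<gamma>\<in>\<Gamma>. \<epsilon> \<gamma> * winding_number \<gamma> (m j)))"
    unfolding sum_distrib_left by (rule sum.swap)
  also have "\<dots> = (\<Sum>j\<in>J. - 2 * pi * \<i> * (c j * f (m j)))"
    by (intro sum.cong refl) (simp only: once J mult_1_right)
  also have "\<dots> = - 2 * pi * \<i> * (\<Sum>j\<in>J. c j * f (m j))"
    by (simp only: sum_distrib_left)
  finally have "- 2 * pi * \<i> * (\<Sum>j\<in>J. c j * f (m j)) = (\<Sum>\<gamma>\<in>\<Gamma>. \<epsilon> \<gamma> * IR \<gamma>)" ..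
  also have "\<dots> = (\<Sum>\<gamma>\<in>\<Gamma>. \<epsilon> \<gamma> * (of_real E * IX \<gamma> - IY \<gamma>))"
    by (simp add: IY_def)
  finally have eq: "- 2 * pi * \<i> * (\<Sum>j\<in>J. c j * f (m j)) = \<dots>" .
  have "2 * pi * cmod (\<Sum>j\<in>J. c j * f (m j)) = cmod (- 2 * pi * \<i> * (\<Sum>j\<in>J. c j * f (m j)))"
    by (simp add: norm_mult)
  also have "\<dots> \<le> (\<Sum>\<gamma>\<in>\<Gamma>. cmod (\<epsilon> \<gamma> * (of_real E * IX \<gamma> - IY \<gamma>)))"
    unfolding eq by (rule norm_sum)
  \<comment> \<open>The orientation signs have modulus 1 and disappear here.\<close>
  also have "\<dots> \<le> (\<Sum>\<gamma>\<in>\<Gamma>. cmod (IX \<gamma>) * E + cmod (IY \<gamma>))"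
    using E by (intro sum_mono) (auto simp: norm_mult \<epsilon> mult.commute intro!: order_trans[OF norm_triangle_ineq4])
  also have "\<dots> = (\<Sum>\<gamma>\<in>\<Gamma>. cmod (IX \<gamma>)) * E + (\<Sum>\<gamma>\<in>\<Gamma>. cmod (IY \<gamma>))"
    by (simp only: sum.distrib sum_distrib_right)
  finally have real_le: "cmod (\<Sum>j\<in>J. c j * f (m j))
      \<le> 1 / (2 * pi) * ((\<Sum>\<gamma>\<in>\<Gamma>. cmod (IX \<gamma>)) * E + (\<Sum>\<gamma>\<in>\<Gamma>. cmod (IY \<gamma>)))"
    by (simp add: pos_le_divide_eq mult.commute)
  have SX: "ennreal (\<Sum>\<gamma>\<in>\<Gamma>. cmod (IX \<gamma>)) \<le> arc_integral \<Gamma> gX"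
    unfolding arc_integral_def
    by (subst sum_ennreal[symmetric], simp,
        intro sum_mono norm_contour_integral_le_nn_integral[OF IX] gX)
  have SY: "ennreal (\<Sum>\<gamma>\<in>\<Gamma>. cmod (IY \<gamma>)) \<le> arc_integral \<Gamma> gY"
    unfolding arc_integral_def
    by (subst sum_ennreal[symmetric], simp,
        intro sum_mono norm_contour_integral_le_nn_integral[OF IY] gY)
  have "ennreal (cmod (\<Sum>j\<in>J. c j * f (m j)))
      \<le> ennreal (1 / (2 * pi) * ((\<Sum>\<gamma>\<in>\<Gamma>. cmod (IX \<gamma>)) * E + (\<Sum>\<gamma>\<in>\<Gamma>. cmod (IY \<gamma>))))"
    using real_le by (rule ennreal_leI)
  also have "\<dots> = ennreal (1 / (2 * pi)) * (ennreal (\<Sum>\<gamma>\<in>\<Gamma>. cmod (IX \<gamma>)) * ennreal E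
      + ennreal (\<Sum>\<gamma>\<in>\<Gamma>. cmod (IY \<gamma>)))"
    using E by (subst ennreal_mult'', simp add: sum_nonneg, subst ennreal_plus)
      (simp_all add: sum_nonneg ennreal_mult'')
  also have "\<dots> \<le> ennreal (1 / (2 * pi)) * (arc_integral \<Gamma> gX * ennreal E + arc_integral \<Gamma> gY)"
    by (intro mult_left_mono[OF add_mono[OF mult_right_mono[OF SX] SY]]) auto
  also have "\<dots> = (ennreal (1 / (2 * pi)) * arc_integral \<Gamma> gX) * ennreal E
      + ennreal (1 / (2 * pi)) * arc_integral \<Gamma> gY"
    by (simp only: distrib_left mult.assoc)
  finally show ?thesis .
qed

section \<open>Functional calculus\<close>

lemma eigendecompositionD:
  assumes "eigendecomposition A U d" "A \<in> carrier_mat n n"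
  shows "U \<in> carrier_mat n n" "U * mat_adjoint U = 1\<^sub>m n" "mat_adjoint U * U = 1\<^sub>m n"
    "A = U * mat_diag n d * mat_adjoint U"
    "mat_fun f A = U * mat_diag n (\<lambda>i. f (d i)) * mat_adjoint U"
  using assms mat_fun_eigendecomposition[OF assms(1)]
  by (auto simp: eigendecomposition_def Let_def)

text \<open>With one eigendecomposition fixed, products of matrix functions become pointwise
  products on the eigenvalues \<open>d\<close>. Shifts, resolvents and h(A) are all treated as
  matrix functions in this way.\<close>

locale diagonalized =
  fixes A U :: "complex mat" and d :: "nat \<Rightarrow> complex" and n :: nat
  assumes A: "A \<in> carrier_mat n n" and decomp: "eigendecomposition A U d"
begin

lemmas U = eigendecompositionD(1)[OF decomp A]
  and UU = eigendecompositionD(2,3)[OF decomp A]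
  and A_eq = eigendecompositionD(4)[OF decomp A]
  and mat_fun_eq = eigendecompositionD(5)[OF decomp A]

lemma U_adj: "mat_adjoint U \<in> carrier_mat n n" using U by simp

lemmas mc = mult_carrier_mat[where nr = n and n = n and nc = n]
lemmas assoc = assoc_mult_mat[where n\<^sub>1 = n and n\<^sub>2 = n and n\<^sub>3 = n and n\<^sub>4 = n]

lemma cancel: "mat_adjoint U * (U * X) = X" if "X \<in> carrier_mat n n"
  using that U U_adj UU by (metis assoc left_mult_one_mat)

lemma mat_fun_carrier [simp]: "mat_fun f A \<in> carrier_mat n n"
  unfolding mat_fun_eq using U U_adj by (intro mc) auto

lemma mat_fun_cong: "(\<And>i. i < n \<Longrightarrow> f (d i) = g (d i)) \<Longrightarrow> mat_fun f A = mat_fun g A"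
  unfolding mat_fun_eq by (rule arg_cong[of _ _ "\<lambda>X. U * X * mat_adjoint U"]) (auto simp: mat_diag_def)

lemma mat_fun_mult: "mat_fun f A * mat_fun g A = mat_fun (\<lambda>x. f x * g x) A"
proof -
  have "mat_fun f A * mat_fun g A = U * (mat_diag n (\<lambda>i. f (d i)) * mat_diag n (\<lambda>i. g (d i)) * mat_adjoint U)"
    unfolding mat_fun_eq using U U_adj by (simp add: assoc mc cancel del: mat_diag_diag)
  then show ?thesis
    unfolding mat_fun_eq mat_diag_diag using U U_adj by (simp add: assoc mc)
qed

lemma mat_fun_one: "mat_fun (\<lambda>_. 1) A = 1\<^sub>m n"
  unfolding mat_fun_eq using U UU by simp

lemma shift_mat_carrier: "shift_mat A z \<in> carrier_mat n n" using A by auto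

text \<open>Conjugation by the unitary \<open>U\<close> fixes multiples of the identity, so the
  shift belongs to the functional calculus.\<close>

lemma shift_mat_eq_mat_fun: "shift_mat A z = mat_fun (\<lambda>x. x - z) A"
proof -
  have diff: "mat_diag n (\<lambda>i. d i - z) = mat_diag n d - z \<cdot>\<^sub>m 1\<^sub>m n"
    by (intro eq_matI) (auto simp: mat_diag_def)
  have "mat_fun (\<lambda>x. x - z) A = (U * mat_diag n d - z \<cdot>\<^sub>m U) * mat_adjoint U"
    unfolding mat_fun_eq diff using U
    by (simp add: mult_minus_distrib_mat[of _ n n _ n] mult_smult_distrib[of _ n n _ n])
  also have "\<dots> = U * mat_diag n d * mat_adjoint U - z \<cdot>\<^sub>m (U * mat_adjoint U)"
    using U U_adj
    by (subst minus_mult_distrib_mat[of _ n n _ _ n]) (auto simp: mult_smult_assoc_mat[of _ n n _ n])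
  also have "\<dots> = shift_mat A z"
    unfolding A_eq[symmetric] UU(1) using A by simp
  finally show ?thesis ..
qed

lemma det_mat_fun: "det (mat_fun g A) = (\<Prod>i<n. g (d i))"
proof -
  have "similar_mat_wit (mat_fun g A) (mat_diag n (\<lambda>i. g (d i))) U (mat_adjoint U)"
    using U U_adj UU mat_fun_eq by (intro similar_mat_witI[of _ _ n]) auto
  then have "similar_mat (mat_fun g A) (mat_diag n (\<lambda>i. g (d i)))"
    unfolding similar_mat_def by blast
  then have "det (mat_fun g A) = det (mat_diag n (\<lambda>i. g (d i)))" by (rule det_similar)
  also have "\<dots> = prod_list (diag_mat (mat_diag n (\<lambda>i. g (d i))))"
    by (rule det_upper_triangular[of _ n]) (auto simp: mat_diag_def)
  also have "\<dots> = (\<Prod>i<n. g (d i))"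
    unfolding prod_list_diag_prod by (simp add: mat_diag_def atLeast0LessThan)
  finally show ?thesis .
qed

text \<open>Ties \<open>d\<close>, with multiplicities, to the characteristic polynomial. This shows
  that every \<open>d i\<close> is an eigenvalue and later allows the comparison with the prescribed
  list \<open>lam\<close>.\<close>

lemma poly_char_poly: "poly (char_poly A) z = (\<Prod>i<n. z - d i)"
proof -
  have "- char_matrix A z = (- 1) \<cdot>\<^sub>m shift_mat A z"
    using A by (intro eq_matI) (auto simp: char_matrix_def)
  then have "poly (char_poly A) z = (- 1) ^ n * det (shift_mat A z)"
    using A by (simp add: char_poly_matrix[OF A] det_smult)
  also have "\<dots> = (\<Prod>i<n. (- 1) * (d i - z))"
    by (simp only: shift_mat_eq_mat_fun det_mat_fun prod.distrib prod_constant card_lessThan)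
  finally show ?thesis by simp
qed

lemma diag_in_spectrum: "i < n \<Longrightarrow> d i \<in> spectrum A"
  unfolding spectrum_root_char_poly[OF A] poly_char_poly by auto

text \<open>The pointwise reciprocal gives an explicit two-sided inverse. Its existence rules out
  that \<open>mat_inverse\<close> returns \<open>None\<close>, and uniqueness of inverses identifies
  the result.\<close>

lemma resolvent_eq_mat_fun:
  assumes "z \<notin> spectrum A"
  shows "resolvent A z = mat_fun (\<lambda>x. 1 / (x - z)) A"
proof -
  let ?M = "shift_mat A z" and ?R = "mat_fun (\<lambda>x. 1 / (x - z)) A"
  have ne: "d i - z \<noteq> 0" if "i < n" for i using diag_in_spectrum[OF that] assms by auto
  have inv: "?M * ?R = 1\<^sub>m n" "?R * ?M = 1\<^sub>m n"
    unfolding shift_mat_eq_mat_fun mat_fun_mult mat_fun_one[symmetric]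
    by (auto intro!: mat_fun_cong dest!: ne)
  have "?M \<in> Units (ring_mat TYPE(complex) n ())"
    unfolding Units_def using inv shift_mat_carrier by (auto simp: ring_mat_def)
  then obtain B where B: "mat_inverse ?M = Some B"
    using mat_inverse(1)[OF shift_mat_carrier, where b = "()"] by (cases "mat_inverse ?M") auto
  from mat_inverse(2)[OF shift_mat_carrier B]
  have BM: "B * ?M = 1\<^sub>m n" and Bc: "B \<in> carrier_mat n n" by auto
  have "B = B * (?M * ?R)" unfolding inv using Bc by simp
  also have "\<dots> = (B * ?M) * ?R"
    by (rule assoc_mult_mat[OF Bc shift_mat_carrier mat_fun_carrier, symmetric])
  also have "\<dots> = ?R" unfolding BM by (rule left_mult_one_mat[OF mat_fun_carrier])
  finally have "B = ?R" .
  then show ?thesis by (simp only: resolvent_def B option.sel)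
qed

lemma resolvent_carrier: "z \<notin> spectrum A \<Longrightarrow> resolvent A z \<in> carrier_mat n n"
  by (simp add: resolvent_eq_mat_fun)

lemma shift_mat_resolvent:
  assumes "z \<notin> spectrum A"
  shows "shift_mat A z * resolvent A z = 1\<^sub>m n"
proof -
  have "d i - z \<noteq> 0" if "i < n" for i using diag_in_spectrum[OF that] assms by auto
  then show ?thesis
    unfolding resolvent_eq_mat_fun[OF assms] shift_mat_eq_mat_fun mat_fun_mult mat_fun_one[symmetric]
    by (intro mat_fun_cong) auto
qed

text \<open>Converts a residual at \<open>z\<close> into a vector measured by the norm: applying
  h(A) to (A - z I) err gives (A - w I) err.\<close>

lemma hfun_mult_shift_mat:
  assumes "z \<notin> spectrum A"
  shows "mat_fun (hfun w z) A * shift_mat A z = shift_mat A w"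
proof -
  have "d i - z \<noteq> 0" if "i < n" for i using diag_in_spectrum[OF that] assms by auto
  then show ?thesis
    unfolding shift_mat_eq_mat_fun mat_fun_mult
    by (intro mat_fun_cong) (auto simp: hfun_def)
qed

lemma mat_fun_mult_vec:
  assumes b: "b \<in> carrier_vec n"
  shows "mat_fun g A *\<^sub>v b = U *\<^sub>v (mat_diag n (\<lambda>i. g (d i)) *\<^sub>v (mat_adjoint U *\<^sub>v b))"
  unfolding mat_fun_eq
  by (simp only: assoc_mult_mat_vec[OF mc[OF U mat_diag_dim] U_adj b]
      assoc_mult_mat_vec[OF U mat_diag_dim mult_mat_vec_carrier[OF U_adj b]])

text \<open>In eigenvector coordinates a tested matrix function is a weighted sum of values of
  \<open>g\<close>. The weights do not depend on \<open>g\<close>, so the same ones serve for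
  \<open>f\<close> and for the Cauchy kernel.\<close>

lemma mat_fun_mult_vec_cscalar_prod:
  assumes b: "b \<in> carrier_vec n" and v: "v \<in> carrier_vec n"
  shows "(mat_fun g A *\<^sub>v b) \<bullet>c v
    = (\<Sum>j<n. ((mat_adjoint U *\<^sub>v b) $ j * cnj ((mat_adjoint U *\<^sub>v v) $ j)) * g (d j))"
proof -
  let ?b = "mat_adjoint U *\<^sub>v b"
  have bc: "?b \<in> carrier_vec n" using U_adj b by simp
  have "(mat_fun g A *\<^sub>v b) \<bullet>c v = (mat_diag n (\<lambda>i. g (d i)) *\<^sub>v ?b) \<bullet>c (mat_adjoint U *\<^sub>v v)"
    using cscalar_prod_adjoint[OF U _ v, of "mat_diag n (\<lambda>i. g (d i)) *\<^sub>v ?b"] bc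
    by (simp add: mult_mat_diag_vec mat_fun_mult_vec[OF b])
  also have "\<dots> = (\<Sum>j<n. (?b $ j * cnj ((mat_adjoint U *\<^sub>v v) $ j)) * g (d j))"
    unfolding mult_mat_diag_vec[OF bc] scalar_prod_def
    using U v by (intro sum.cong) (auto simp: mult_ac)
  finally show ?thesis .
qed

lemma vnorm2_mat_fun_le:
  assumes v: "v \<in> carrier_vec n" and M: "\<And>i. i < n \<Longrightarrow> cmod (g (d i)) \<le> M" and M0: "M \<ge> 0"
  shows "vnorm2 (mat_fun g A *\<^sub>v v) \<le> M * vnorm2 v"
proof -
  let ?v = "mat_adjoint U *\<^sub>v v" and ?D = "mat_diag n (\<lambda>i. g (d i))"
  have vc: "?v \<in> carrier_vec n" using U_adj v by simp
  have "vnorm2 (mat_fun g A *\<^sub>v v) = vnorm2 (?D *\<^sub>v ?v)"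
    using vnorm2_isometry[OF U UU(2), of "?D *\<^sub>v ?v"] vc
    by (simp add: mult_mat_diag_vec mat_fun_mult_vec[OF v])
  also have "\<dots> \<le> M * vnorm2 ?v" using vc M M0 by (rule vnorm2_mat_diag_le)
  also have "vnorm2 ?v = vnorm2 v"
    using vnorm2_isometry[OF U_adj _ v] UU by simp
  finally show ?thesis .
qed

end

section \<open>The weighted norm and the corner entry of a tridiagonal resolvent\<close>

lemma hermitian_shift_mat:
  assumes A: "A \<in> carrier_mat n n" and "hermitian_mat A"
  shows "mat_adjoint (shift_mat A (complex_of_real w)) = shift_mat A (complex_of_real w)"
proof (rule eq_matI)
  fix i j assume "i < dim_row (shift_mat A (complex_of_real w))" "j < dim_col (shift_mat A (complex_of_real w))"
  then have ij: "i < n" "j < n" using A by auto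
  have "cnj (A $$ (j, i)) = A $$ (i, j)"
    using mat_adjoint_index[of i A j] ij A assms(2) unfolding hermitian_mat_def by auto
  then show "mat_adjoint (shift_mat A (complex_of_real w)) $$ (i, j) = shift_mat A (complex_of_real w) $$ (i, j)"
    using ij A by (auto simp: mat_adjoint_index)
qed (use A in auto)

text \<open>Since \<open>w\<close> is real, the shifted matrix is Hermitian and one of its two
  factors moves to the other side of the inner product.\<close>

lemma mnorm_shift_mat_square:
  assumes A: "A \<in> carrier_mat n n" and "hermitian_mat A" and v: "v \<in> carrier_vec n"
  shows "mnorm (shift_mat A (complex_of_real w) ^\<^sub>m 2) v = vnorm2 (shift_mat A (complex_of_real w) *\<^sub>v v)"
proof -
  let ?M = "shift_mat A (complex_of_real w)"
  have M: "?M \<in> carrier_mat n n" using A by auto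
  have "?M ^\<^sub>m 2 = ?M * ?M" using M by (simp add: numeral_2_eq_2)
  then have "(?M ^\<^sub>m 2 *\<^sub>v v) \<bullet>c v = (?M *\<^sub>v (?M *\<^sub>v v)) \<bullet>c v"
    using M v by simp
  also have "\<dots> = (?M *\<^sub>v v) \<bullet>c (?M *\<^sub>v v)"
    using cscalar_prod_adjoint[OF M _ v, of "?M *\<^sub>v v"] M v by (simp add: hermitian_shift_mat[OF assms(1,2)])
  finally show ?thesis by (simp add: mnorm_def vnorm2_def)
qed

text \<open>
  Deleting the first row and last column leaves an upper triangular matrix with the subdiagonal of
  \<open>T\<close> on its diagonal, so \<open>z\<close> disappears from the determinant.
\<close>

lemma cofactor_shift_tridiagonal:
  assumes T: "T \<in> carrier_mat k k" and tri: "tridiagonal_mat T" and k: "k \<ge> 1"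
  shows "cofactor (shift_mat (cmat T) z) 0 (k - 1)
    = (- 1) ^ (k - 1) * (\<Prod>i<k - 1. complex_of_real (T $$ (Suc i, i)))"
proof -
  define M where "M = mat_delete (shift_mat (cmat T) z) 0 (k - 1)"
  have M: "M \<in> carrier_mat (k - 1) (k - 1)"
    unfolding M_def using T by (intro mat_delete_carrier) auto
  have ent: "M $$ (i, j) = complex_of_real (T $$ (Suc i, j)) - (if Suc i = j then z else 0)"
    if "i < k - 1" "j < k - 1" for i j
    using that T by (auto simp: M_def mat_delete_def)
  have "upper_triangular M"
  proof
    fix i j assume "j < i" "i < dim_row M"
    then have "j < i" "i < k - 1" using M by auto
    then show "M $$ (i, j) = 0" using T tri by (simp add: ent tridiagonal_mat_def)
  qed
  then have "det M = (\<Prod>i<k - 1. M $$ (i, i))"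
    using det_upper_triangular[OF _ M] M by (simp add: prod_list_diag_prod atLeast0LessThan)
  also have "\<dots> = (\<Prod>i<k - 1. complex_of_real (T $$ (Suc i, i)))"
    by (intro prod.cong) (auto simp: ent)
  finally show ?thesis unfolding cofactor_def M_def by simp
qed

text \<open>Cramer's rule: the adjugate is the determinant times the inverse, and its entry
  \<open>(k - 1, 0)\<close> is the cofactor at the transposed position. The right-hand side is free
  of \<open>z\<close>, which makes two shifts comparable.\<close>

lemma resolvent_tridiagonal_corner:
  assumes T: "T \<in> carrier_mat k k" and "tridiagonal_mat T" and k: "k \<ge> 1"
    and R: "R \<in> carrier_mat k k" "shift_mat (cmat T) z * R = 1\<^sub>m k"
  shows "det (shift_mat (cmat T) z) * R $$ (k - 1, 0)
    = (- 1) ^ (k - 1) * (\<Prod>i<k - 1. complex_of_real (T $$ (Suc i, i)))"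
proof -
  define M where "M = shift_mat (cmat T) z"
  have M: "M \<in> carrier_mat k k" using T by (auto simp: M_def)
  note adj = adj_mat[OF M]
  have "adj_mat M = adj_mat M * (M * R)" using adj(1) R by (simp add: M_def)
  also have "\<dots> = (adj_mat M * M) * R"
    by (rule assoc_mult_mat[OF adj(1) M R(1), symmetric])
  also have "\<dots> = det M \<cdot>\<^sub>m R"
    unfolding adj(3) using R by (simp add: mult_smult_assoc_mat[of _ k k _ k])
  finally have "adj_mat M $$ (k - 1, 0) = det M * R $$ (k - 1, 0)"
    using R k by simp
  moreover have "adj_mat M $$ (k - 1, 0) = cofactor M 0 (k - 1)"
    using M k by (simp add: adj_mat_def)
  ultimately show ?thesis
    using cofactor_shift_tridiagonal[OF assms(1-3)] unfolding M_def by simp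
qed

section \<open>The perturbed Lanczos recurrence\<close>

lemma shift_mat_mult_vec:
  assumes "M \<in> carrier_mat n n" "v \<in> carrier_vec n"
  shows "shift_mat M z *\<^sub>v v = M *\<^sub>v v - z \<cdot>\<^sub>v v"
proof -
  have "shift_mat M z *\<^sub>v v = M *\<^sub>v v - (z \<cdot>\<^sub>m 1\<^sub>m n) *\<^sub>v v"
    using assms by (simp add: minus_mult_distrib_mat_vec[of _ n n])
  also have "(z \<cdot>\<^sub>m 1\<^sub>m n) *\<^sub>v v = z \<cdot>\<^sub>v v"
    using assms by (intro eq_vecI) auto
  finally show ?thesis .
qed

lemma mult_unit_vec:
  fixes M :: "complex mat"
  assumes "M \<in> carrier_mat n k" "j < k"
  shows "M *\<^sub>v unit_vec k j = col M j"
  using assms by (intro eq_vecI) auto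

text \<open>The product of the one-column and the one-row matrix is the outer product of
  \<open>q\<close> with the last basis vector, so it only sees the last entry of
  \<open>y\<close>.\<close>

lemma rank_one_mult_vec:
  fixes q :: "complex vec"
  assumes q: "q \<in> carrier_vec n" and y: "y \<in> carrier_vec k" and k: "k \<ge> 1"
  shows "(c \<cdot>\<^sub>m (mat_of_cols n [q] * mat_of_rows k [unit_vec k (k - 1)])) *\<^sub>v y = (c * y $ (k - 1)) \<cdot>\<^sub>v q"
proof (rule eq_vecI)
  let ?P = "mat_of_cols n [q] * mat_of_rows k [unit_vec k (k - 1)]"
  fix i assume "i < dim_vec ((c * y $ (k - 1)) \<cdot>\<^sub>v q)"
  then have i: "i < n" using q by simp
  have ent: "(c \<cdot>\<^sub>m ?P) $$ (i, j) = (if j = k - 1 then c * q $ i else 0)" if "j < k" for j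
    using i that k by (auto simp: scalar_prod_def mat_of_cols_def mat_of_rows_def unit_vec_def)
  have "((c \<cdot>\<^sub>m ?P) *\<^sub>v y) $ i = (\<Sum>j<k. (c \<cdot>\<^sub>m ?P) $$ (i, j) * y $ j)"
    using i y by (simp add: scalar_prod_def atLeast0LessThan)
  also have "\<dots> = (\<Sum>j<k. if j = k - 1 then c * q $ i * y $ j else 0)"
    by (intro sum.cong refl) (simp only: ent lessThan_iff if_distrib[of "\<lambda>x. x * _"] mult_zero_left)
  also have "\<dots> = c * q $ i * y $ (k - 1)" using k by simp
  finally show "((c \<cdot>\<^sub>m ?P) *\<^sub>v y) $ i = ((c * y $ (k - 1)) \<cdot>\<^sub>v q) $ i" using i q by simp
qed (use q in auto)

locale perturbed_lanczos =
  fixes n k :: nat and A Q F :: "complex mat" and T :: "real mat"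
    and b q :: "complex vec" and \<beta> :: real
  assumes A: "A \<in> carrier_mat n n"
    and b: "b \<in> carrier_vec n" "b \<noteq> 0\<^sub>v n"
    and k: "k \<ge> 1"
    and Q: "Q \<in> carrier_mat n k" "col Q 0 = complex_of_real (1 / vnorm2 b) \<cdot>\<^sub>v b"
    and T: "T \<in> carrier_mat k k" "tridiagonal_mat T"
    and q: "q \<in> carrier_vec n"
    and F: "F \<in> carrier_mat n k"
    and recurrence: "A * Q = Q * cmat T
           + complex_of_real \<beta> \<cdot>\<^sub>m (mat_of_cols n [q] * mat_of_rows k [unit_vec k (k - 1)]) + F"
begin

lemma cT: "cmat T \<in> carrier_mat k k" using T by simp

lemma vnorm2_b: "vnorm2 b \<noteq> 0" using b by (simp add: vnorm2_eq_0_iff)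

text \<open>The recurrence survives the shift, because the term \<open>z\<close> times
  \<open>Q y\<close> is subtracted on both sides.\<close>

lemma shift_mat_mult_Q:
  assumes y: "y \<in> carrier_vec k"
  shows "shift_mat A z *\<^sub>v (Q *\<^sub>v y) = Q *\<^sub>v (shift_mat (cmat T) z *\<^sub>v y)
    + ((complex_of_real \<beta> * y $ (k - 1)) \<cdot>\<^sub>v q + F *\<^sub>v y)"
proof -
  let ?R = "complex_of_real \<beta> \<cdot>\<^sub>m (mat_of_cols n [q] * mat_of_rows k [unit_vec k (k - 1)])"
  have R: "?R \<in> carrier_mat n k" by auto
  have Qy: "Q *\<^sub>v y \<in> carrier_vec n" using Q y by simp
  have QT: "Q * cmat T \<in> carrier_mat n k" using Q cT by simp
  have "A *\<^sub>v (Q *\<^sub>v y) = (Q * cmat T + ?R + F) *\<^sub>v y"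
    using assoc_mult_mat_vec[OF A Q(1) y] recurrence by simp
  also have "\<dots> = (Q * cmat T) *\<^sub>v y + ?R *\<^sub>v y + F *\<^sub>v y"
    by (simp only: add_mult_distrib_mat_vec[OF add_carrier_mat[OF R] F y] QT
        add_mult_distrib_mat_vec[OF QT R y])
  also have "\<dots> = Q *\<^sub>v (cmat T *\<^sub>v y) + (complex_of_real \<beta> * y $ (k - 1)) \<cdot>\<^sub>v q + F *\<^sub>v y"
    by (simp only: assoc_mult_mat_vec[OF Q(1) cT y] rank_one_mult_vec[OF q y k])
  finally have AQ: "A *\<^sub>v (Q *\<^sub>v y) = \<dots>" .
  have Ty: "cmat T *\<^sub>v y \<in> carrier_vec k" using cT y by simp
  have "Q *\<^sub>v (shift_mat (cmat T) z *\<^sub>v y) = Q *\<^sub>v (cmat T *\<^sub>v y) - z \<cdot>\<^sub>v (Q *\<^sub>v y)"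
    unfolding shift_mat_mult_vec[OF cT y]
    using mult_minus_distrib_mat_vec[OF Q(1) Ty, of "z \<cdot>\<^sub>v y"] mult_mat_vec[OF Q(1) y] y by simp
  then show ?thesis
    unfolding shift_mat_mult_vec[OF A Qy] AQ
    using q F Q y Ty by (intro eq_vecI) auto
qed

text \<open>For this \<open>y\<close> the vector (T - z I) y is the first basis vector, which
  \<open>Q\<close> maps to the normalized \<open>b\<close>. After scaling by the norm of
  \<open>b\<close> it cancels the residual \<open>b\<close> of the exact solution, leaving only the
  \<open>q\<close> and \<open>F\<close> terms.\<close>

lemma shift_mat_mult_err:
  assumes RA: "resolvent A z \<in> carrier_mat n n" "shift_mat A z * resolvent A z = 1\<^sub>m n"
    and RT: "resolvent (cmat T) z \<in> carrier_mat k k" "shift_mat (cmat T) z * resolvent (cmat T) z = 1\<^sub>m k"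
  defines "y \<equiv> resolvent (cmat T) z *\<^sub>v unit_vec k 0"
  shows "shift_mat A z *\<^sub>v err A Q T b z
    = - complex_of_real (vnorm2 b) \<cdot>\<^sub>v ((complex_of_real \<beta> * y $ (k - 1)) \<cdot>\<^sub>v q + F *\<^sub>v y)"
proof -
  let ?M = "shift_mat A z" and ?\<nu> = "complex_of_real (vnorm2 b)"
  have M: "?M \<in> carrier_mat n n" using A by auto
  have TM: "shift_mat (cmat T) z \<in> carrier_mat k k" using cT by auto
  have y: "y \<in> carrier_vec k" using RT by (simp add: y_def)
  have Qy: "Q *\<^sub>v y \<in> carrier_vec n" using Q y by simp
  have "shift_mat (cmat T) z *\<^sub>v y = unit_vec k 0"
    unfolding y_def using assoc_mult_mat_vec[OF TM RT(1), of "unit_vec k 0"] RT(2) by simp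
  then have MQy: "?M *\<^sub>v (Q *\<^sub>v y) = complex_of_real (1 / vnorm2 b) \<cdot>\<^sub>v b
      + ((complex_of_real \<beta> * y $ (k - 1)) \<cdot>\<^sub>v q + F *\<^sub>v y)"
    using mult_unit_vec[OF Q(1), of 0] Q(2) k by (simp add: shift_mat_mult_Q[OF y] del: of_real_divide)
  have "?M *\<^sub>v err A Q T b z = ?M *\<^sub>v (resolvent A z *\<^sub>v b) - ?M *\<^sub>v (?\<nu> \<cdot>\<^sub>v (Q *\<^sub>v y))"
    unfolding err_def y_def using T M RA b Qy
    by (subst mult_minus_distrib_mat_vec[OF M]) (auto simp: y_def)
  also have "?M *\<^sub>v (resolvent A z *\<^sub>v b) = b"
    using assoc_mult_mat_vec[OF M RA(1) b(1)] RA(2) b by simp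
  also have "?M *\<^sub>v (?\<nu> \<cdot>\<^sub>v (Q *\<^sub>v y)) = ?\<nu> \<cdot>\<^sub>v (?M *\<^sub>v (Q *\<^sub>v y))"
    using M Qy by (rule mult_mat_vec)
  also note MQy
  finally have eq: "?M *\<^sub>v err A Q T b z = b - ?\<nu> \<cdot>\<^sub>v (complex_of_real (1 / vnorm2 b) \<cdot>\<^sub>v b
      + ((complex_of_real \<beta> * y $ (k - 1)) \<cdot>\<^sub>v q + F *\<^sub>v y))" .
  show ?thesis
    unfolding eq using b q F y vnorm2_b by (intro eq_vecI) (auto simp: algebra_simps)
qed

end

context perturbed_lanczos
begin

text \<open>The residuals at \<open>z\<close> and \<open>w\<close> contain multiples of the same
  vector \<open>q\<close>. Their coefficients differ by the factor det h(T), so subtracting that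
  multiple of the residual at \<open>w\<close> removes \<open>q\<close>, and the remaining
  \<open>F\<close> terms are exactly \<open>pert\<close>.\<close>

lemma shift_mat_mult_err_transfer:
  assumes DA: "diagonalized A U d n" and DT: "diagonalized (cmat T) V e k"
    and z: "z \<notin> spectrum A \<union> spectrum (cmat T)" and w: "w \<notin> spectrum A \<union> spectrum (cmat T)"
  shows "shift_mat A z *\<^sub>v err A Q T b z
    = det (mat_fun (hfun w z) (cmat T)) \<cdot>\<^sub>v (shift_mat A w *\<^sub>v err A Q T b w) - pert F T b w z"
proof -
  interpret DA: diagonalized A U d n by (fact DA)
  interpret DT: diagonalized "cmat T" V e k by (fact DT)
  define D where "D = det (mat_fun (hfun w z) (cmat T))"
  define y where "y x = resolvent (cmat T) x *\<^sub>v unit_vec k 0" for x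
  \<comment> \<open>The common value, at \<open>z\<close> and at \<open>w\<close>, of the corner
    entry times the determinant of the shifted matrix.\<close>
  define \<kappa> where "\<kappa> = (- 1) ^ (k - 1) * (\<Prod>i<k - 1. complex_of_real (T $$ (Suc i, i)))"
  have res: "resolvent (cmat T) x \<in> carrier_mat k k" if "x \<notin> spectrum (cmat T)" for x
    using that by (rule DT.resolvent_carrier)
  have yc: "y x \<in> carrier_vec k" if "x \<notin> spectrum (cmat T)" for x
    using res[OF that] by (simp add: y_def)
  have corner: "det (shift_mat (cmat T) x) * y x $ (k - 1) = \<kappa>" if x: "x \<notin> spectrum (cmat T)" for x
  proof -
    have "y x $ (k - 1) = resolvent (cmat T) x $$ (k - 1, 0)"
      using mult_unit_vec[OF res[OF x], of 0] res[OF x] k by (simp add: y_def)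
    then show ?thesis
      using resolvent_tridiagonal_corner[OF T k res[OF x] DT.shift_mat_resolvent[OF x]]
      by (simp add: \<kappa>_def)
  qed
  have dx: "det (shift_mat (cmat T) x) = (\<Prod>i<k. e i - x)" for x
    unfolding DT.shift_mat_eq_mat_fun DT.det_mat_fun ..
  have ne: "(\<Prod>i<k. e i - x) \<noteq> 0" if "x \<notin> spectrum (cmat T)" for x
    using DT.diag_in_spectrum that by auto
  have D: "D = (\<Prod>i<k. e i - w) / (\<Prod>i<k. e i - z)"
    unfolding D_def DT.det_mat_fun hfun_def by (rule prod_dividef)
  \<comment> \<open>Both products equal \<kappa>, so the ratio of the corner entries is det (T - w
    I) / det (T - z I), which is \<open>D\<close>.\<close>
  have ywz: "y z $ (k - 1) = D * y w $ (k - 1)"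
    using corner[of z] corner[of w] ne[of z] z w unfolding dx D by (auto simp: field_simps)
  have resid: "shift_mat A x *\<^sub>v err A Q T b x
      = - complex_of_real (vnorm2 b) \<cdot>\<^sub>v ((complex_of_real \<beta> * y x $ (k - 1)) \<cdot>\<^sub>v q + F *\<^sub>v y x)"
    if "x \<notin> spectrum A \<union> spectrum (cmat T)" for x
    unfolding y_def using that
    by (intro shift_mat_mult_err DA.resolvent_carrier DA.shift_mat_resolvent
        DT.resolvent_carrier DT.shift_mat_resolvent) auto
  have yz: "y z \<in> carrier_vec k" and yw: "y w \<in> carrier_vec k" using yc z w by auto
  have Rz: "resolvent (cmat T) z \<in> carrier_mat k k" and Rw: "resolvent (cmat T) w \<in> carrier_mat k k"
    using res z w by auto
  have "(resolvent (cmat T) z - D \<cdot>\<^sub>m resolvent (cmat T) w) *\<^sub>v unit_vec k 0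
      = y z - (D \<cdot>\<^sub>m resolvent (cmat T) w) *\<^sub>v unit_vec k 0"
    unfolding y_def using Rz Rw by (intro minus_mult_distrib_mat_vec) auto
  also have "(D \<cdot>\<^sub>m resolvent (cmat T) w) *\<^sub>v unit_vec k 0 = D \<cdot>\<^sub>v y w"
    unfolding y_def using Rw by (intro eq_vecI) auto
  finally have "F *\<^sub>v ((resolvent (cmat T) z - D \<cdot>\<^sub>m resolvent (cmat T) w) *\<^sub>v unit_vec k 0)
      = F *\<^sub>v (y z - D \<cdot>\<^sub>v y w)" by simp
  also have "\<dots> = F *\<^sub>v y z - D \<cdot>\<^sub>v (F *\<^sub>v y w)"
    using mult_minus_distrib_mat_vec[OF F yz, of "D \<cdot>\<^sub>v y w"] mult_mat_vec[OF F yw] yw by simp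
  finally have pert: "pert F T b w z = complex_of_real (vnorm2 b) \<cdot>\<^sub>v (F *\<^sub>v y z - D \<cdot>\<^sub>v (F *\<^sub>v y w))"
    using T by (simp add: pert_def D_def)
  show ?thesis
    unfolding resid[OF z] resid[OF w] pert ywz D_def[symmetric]
    using q F yz yw by (intro eq_vecI) (auto simp: algebra_simps)
qed

end

section \<open>Bounds by suprema of h, and the error estimate\<close>

lemma hnorm_upper:
  assumes "x \<in> S" "complex_of_real x \<noteq> z"
  shows "ennreal (cmod (hfun w z (complex_of_real x))) \<le> hnorm w z S"
  unfolding hnorm_def using assms by (intro SUP_upper2[of x]) auto

text \<open>The supremum \<open>hnorm\<close> may be infinite and cannot itself serve as a real
  operator bound. The real number \<open>M\<close> is the maximum of |h| over the finitely many
  eigenvalues; it is attained at a point of \<open>S\<close> other than \<open>z\<close>, hence lies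
  below the supremum.\<close>

lemma (in diagonalized) hfun_operator_bound:
  assumes n: "n > 0" and S: "spectrum A \<subseteq> complex_of_real ` S" and z: "z \<notin> spectrum A"
  obtains M where "M \<ge> 0" "ennreal M \<le> hnorm w z S"
    "\<And>v. v \<in> carrier_vec n \<Longrightarrow> vnorm2 (mat_fun (hfun w z) A *\<^sub>v v) \<le> M * vnorm2 v"
proof -
  define M where "M = Max ((\<lambda>j. cmod (hfun w z (d j))) ` {..<n})"
  have "M \<in> (\<lambda>j. cmod (hfun w z (d j))) ` {..<n}"
    unfolding M_def using n by (intro Max_in) auto
  then obtain j where j: "j < n" "M = cmod (hfun w z (d j))" by auto
  have le: "cmod (hfun w z (d i)) \<le> M" if "i < n" for i
    unfolding M_def using that by (intro Max_ge) auto
  obtain x where x: "x \<in> S" "d j = complex_of_real x"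
    using diag_in_spectrum[OF j(1)] S by auto
  have "complex_of_real x \<noteq> z" using diag_in_spectrum[OF j(1)] z x by auto
  with x have "ennreal M \<le> hnorm w z S" unfolding j by (simp add: hnorm_upper)
  then show thesis
    using that[of M] j(2) vnorm2_mat_fun_le[where g = "hfun w z" and M = M] le by simp
qed

lemma hermitian_cmat:
  assumes "T \<in> carrier_mat k k" "symmetric_mat T"
  shows "hermitian_mat (cmat T)"
  unfolding hermitian_mat_def
proof (rule eq_matI)
  fix i j assume "i < dim_row (cmat T)" "j < dim_col (cmat T)"
  then have ij: "i < k" "j < k" using assms by auto
  have "T $$ (i, j) = transpose_mat T $$ (i, j)" using assms by (simp add: symmetric_mat_def)
  also have "\<dots> = T $$ (j, i)" using ij assms(1) by simp
  finally show "mat_adjoint (cmat T) $$ (i, j) = cmat T $$ (i, j)"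
    using ij assms(1) by simp
qed (use assms in auto)

theorem mainTheorem4:
  fixes n k :: nat
    and A Q F :: "complex mat" and T :: "real mat"
    and b q :: "complex vec" and \<beta> w :: real
    and f :: "complex \<Rightarrow> complex" and N :: "complex set"
    and \<Gamma> :: "(real \<Rightarrow> complex) set"
    and lam :: "nat \<Rightarrow> real" and S :: "nat \<Rightarrow> real set"
  assumes "A \<in> carrier_mat n n" and "hermitian_mat A"
    and "b \<in> carrier_vec n" and "b \<noteq> 0\<^sub>v n"
    and "k \<ge> 1"
    and "Q \<in> carrier_mat n k" and "col Q 0 = complex_of_real (1 / vnorm2 b) \<cdot>\<^sub>v b"
    and "T \<in> carrier_mat k k" and "symmetric_mat T" and "tridiagonal_mat T"
    and "q \<in> carrier_vec n"
    and "F \<in> carrier_mat n k"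
    and recurrence: "A * Q = Q * cmat T
           + complex_of_real \<beta> \<cdot>\<^sub>m (mat_of_cols n [q] * mat_of_rows k [unit_vec k (k - 1)]) + F"
    and "open N" and "spectrum A \<union> spectrum (cmat T) \<subseteq> N" and "f analytic_on N"
    and "finite \<Gamma>"
    and curves: "\<And>\<gamma>. \<gamma> \<in> \<Gamma> \<Longrightarrow> valid_path \<gamma> \<and> simple_path \<gamma> \<and> pathfinish \<gamma> = pathstart \<gamma>"
    and curves_in_N: "\<And>\<gamma>. \<gamma> \<in> \<Gamma> \<Longrightarrow> path_image \<gamma> \<union> inside (path_image \<gamma>) \<subseteq> N"
    and avoids: "\<And>\<gamma>. \<gamma> \<in> \<Gamma> \<Longrightarrow> path_image \<gamma> \<inter> (spectrum A \<union> spectrum (cmat T)) = {}"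
    and encloses: "\<And>\<mu>. \<mu> \<in> spectrum A \<union> spectrum (cmat T) \<Longrightarrow>
           \<exists>!\<gamma>. \<gamma> \<in> \<Gamma> \<and> \<mu> \<in> inside (path_image \<gamma>)"
    and "complex_of_real w \<notin> spectrum (cmat T) \<union> spectrum A"
    and eigenvalues_T: "char_poly T = (\<Prod>i = 1..k. [:- lam i, 1:])"
    and "spectrum A \<subseteq> complex_of_real ` S 0"
    and "\<And>i. i \<in> {1..k} \<Longrightarrow> lam i \<in> S i"
  defines "nrm \<equiv> mnorm (shift_mat A w ^\<^sub>m 2)"
  shows "ennreal (nrm (mat_fun f A *\<^sub>v b - lan Q T b f))
    \<le> (ennreal (1 / (2 * pi)) *
         arc_integral \<Gamma> (\<lambda>z. ennreal (cmod (f z)) * (\<Prod>i = 1..k. hnorm w z (S i)) * hnorm w z (S 0)))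
        * ennreal (nrm (err A Q T b w))
      + ennreal (1 / (2 * pi)) *
         arc_integral \<Gamma> (\<lambda>z. ennreal (cmod (f z)) * hnorm w z (S 0) * ennreal (vnorm2 (pert F T b w z)))"
proof -

  \<comment> \<open>Diagonalizations, the weight \<open>W\<close> and the vectors \<open>a\<close>
    and \<open>u\<close> to be compared\<close>
  define W where "W = shift_mat A (complex_of_real w)"
  define K where "K = spectrum A \<union> spectrum (cmat T)"
  note A = assms(1) and hA = assms(2) and b = assms(3) and T = assms(8) and Q = assms(6)
  have cT: "cmat T \<in> carrier_mat k k" using T by simp
  interpret L: perturbed_lanczos n k A Q F T b q \<beta>
    using assms by unfold_locales auto
  obtain U d where "eigendecomposition A U d" using hermitian_eigendecomposition[OF A hA] by blast
  then interpret DA: diagonalized A U d n using A by unfold_locales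
  obtain V e where "eigendecomposition (cmat T) V e"
    using hermitian_eigendecomposition[OF cT hermitian_cmat[OF T assms(9)]] by blast
  then interpret DT: diagonalized "cmat T" V e k using cT by unfold_locales
  \<comment> \<open>A nonzero \<open>b\<close> forces positive dimension, so the maximum over the
    eigenvalues of \<open>A\<close> is taken over a nonempty set.\<close>
  have n: "n > 0"
  proof (rule ccontr)
    assume "\<not> n > 0"
    then have "b = 0\<^sub>v n" using b by (intro eq_vecI) auto
    then show False using assms(4) by contradiction
  qed
  have wK: "complex_of_real w \<notin> K" using assms(22) by (auto simp: K_def)
  have W: "W \<in> carrier_mat n n" using A by (auto simp: W_def)
  have nrm: "nrm v = vnorm2 (W *\<^sub>v v)" if "v \<in> carrier_vec n" for v
    unfolding nrm_def W_def using mnorm_shift_mat_square[OF A hA that] by simp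
  have e1: "unit_vec k 0 \<in> carrier_vec k" by simp
  have lanc: "lan Q T b g \<in> carrier_vec n" for g
    using T mult_mat_vec_carrier[OF Q mult_mat_vec_carrier[OF DT.mat_fun_carrier e1]]
    by (simp add: lan_def)
  have gAb: "mat_fun g A *\<^sub>v b \<in> carrier_vec n" for g
    by (rule mult_mat_vec_carrier[OF DA.mat_fun_carrier b])
  \<comment> \<open>The error of the shifted system is the Lanczos error for the function 1/(x - z),
    so a single linear functional handles it together with the error for \<open>f\<close>.\<close>
  have err_eq: "err A Q T b z = mat_fun (\<lambda>x. 1 / (x - z)) A *\<^sub>v b - lan Q T b (\<lambda>x. 1 / (x - z))"
    if "z \<notin> K" for z
    using that unfolding err_def lan_def
    by (simp add: DA.resolvent_eq_mat_fun DT.resolvent_eq_mat_fun K_def)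
  have errc: "err A Q T b z \<in> carrier_vec n" if "z \<notin> K" for z
    unfolding err_eq[OF that] using gAb lanc by simp
  define a where "a = W *\<^sub>v err A Q T b (complex_of_real w)"
  have a: "a \<in> carrier_vec n" using W errc[OF wK] by (simp add: a_def)
  define E where "E = vnorm2 a"
  have E0: "E \<ge> 0" using a by (simp add: E_def vnorm2_nonneg)
  have nrm_err: "nrm (err A Q T b (complex_of_real w)) = E"
    unfolding nrm[OF errc[OF wK]] E_def a_def ..
  define u where "u = W *\<^sub>v (mat_fun f A *\<^sub>v b - lan Q T b f)"
  have u: "u \<in> carrier_vec n" using W gAb lanc by (simp add: u_def)
  have nrm_u: "nrm (mat_fun f A *\<^sub>v b - lan Q T b f) = vnorm2 u"
    using nrm gAb lanc by (simp add: u_def)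
  show ?thesis
  proof (cases "vnorm2 u = 0")
    case True
    then show ?thesis unfolding nrm_u by simp
  next
    case False

    \<comment> \<open>Reduction to scalars by testing against a unit vector\<close>
    have up: "vnorm2 u > 0" using False vnorm2_nonneg[OF u] by simp
    \<comment> \<open>The unit vector along \<open>u\<close>: testing \<open>u\<close> against it
      returns exactly the norm of \<open>u\<close>.\<close>
    define v where "v = complex_of_real (1 / vnorm2 u) \<cdot>\<^sub>v u"
    have v: "v \<in> carrier_vec n" using u by (simp add: v_def)
    have v1: "vnorm2 v = 1"
      unfolding v_def vnorm2_smult[OF u] using up by (simp add: norm_divide)
    have uv: "u \<bullet>c v = complex_of_real (vnorm2 u)"
    proof -
      have "u \<bullet>c v = complex_of_real (1 / vnorm2 u) * (u \<bullet>c u)"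
        using u unfolding v_def conjugate_smult_vec by (subst scalar_prod_smult_distrib[of _ n]) auto
      then show ?thesis
        unfolding cscalar_prod_self_vnorm2[OF u] using up by (simp add: power2_eq_square)
    qed
    define v' where "v' = mat_adjoint W *\<^sub>v v"
    have v': "v' \<in> carrier_vec n"
      unfolding v'_def by (rule mult_mat_vec_carrier[OF mat_adjoint_carrier[OF W] v])
    define s where "s = mat_adjoint Q *\<^sub>v v'"
    have s: "s \<in> carrier_vec k"
      unfolding s_def by (rule mult_mat_vec_carrier[OF mat_adjoint_carrier[OF Q] v'])
    \<comment> \<open>A disjoint sum of index sets: eigenvalues that are repeated or shared by
      \<open>A\<close> and \<open>T\<close> keep separate indices. In \<open>c\<close> the part for
      \<open>T\<close> carries a minus sign because \<open>lan\<close> is subtracted;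
      \<open>W\<close> and \<open>Q\<close> have been moved onto the test vector as
      \<open>v'\<close> and \<open>s\<close>.\<close>
    define J where "J = {..<n} <+> {..<k}"
    define m where "m = case_sum d e"
    define c where "c = case_sum
      (\<lambda>j. (mat_adjoint U *\<^sub>v b) $ j * cnj ((mat_adjoint U *\<^sub>v v') $ j))
      (\<lambda>i. - (complex_of_real (vnorm2 b) *
         ((mat_adjoint V *\<^sub>v unit_vec k 0) $ i * cnj ((mat_adjoint V *\<^sub>v s) $ i))))"
    have functional: "(W *\<^sub>v (mat_fun g A *\<^sub>v b - lan Q T b g)) \<bullet>c v = (\<Sum>j\<in>J. c j * g (m j))" for g
    proof -
      let ?y = "mat_fun g (cmat T) *\<^sub>v unit_vec k 0"
      have y: "?y \<in> carrier_vec k" by (rule mult_mat_vec_carrier[OF DT.mat_fun_carrier e1])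
      have "(W *\<^sub>v (mat_fun g A *\<^sub>v b - lan Q T b g)) \<bullet>c v
          = (mat_fun g A *\<^sub>v b - lan Q T b g) \<bullet>c v'"
        unfolding v'_def using gAb lanc by (intro cscalar_prod_adjoint[OF W _ v]) simp
      also have "\<dots> = (mat_fun g A *\<^sub>v b) \<bullet>c v' - lan Q T b g \<bullet>c v'"
        using gAb lanc v' by (intro minus_scalar_prod_distrib) auto
      also have "lan Q T b g \<bullet>c v' = complex_of_real (vnorm2 b) * ((Q *\<^sub>v ?y) \<bullet>c v')"
        using Q T y v' unfolding lan_def by (subst smult_scalar_prod_distrib[of _ n]) auto
      also have "(Q *\<^sub>v ?y) \<bullet>c v' = ?y \<bullet>c s"
        unfolding s_def by (rule cscalar_prod_adjoint[OF Q y v'])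
      finally show ?thesis
        unfolding DA.mat_fun_mult_vec_cscalar_prod[OF b v'] DT.mat_fun_mult_vec_cscalar_prod[OF e1 s]
        by (simp add: J_def c_def m_def sum.Plus sum_distrib_left sum_negf mult_ac)
    qed
    define \<alpha> where "\<alpha> j = (mat_adjoint U *\<^sub>v a) $ j * cnj ((mat_adjoint U *\<^sub>v v) $ j)" for j
    define D where "D z = (\<Prod>i = 1..k. hfun w z (complex_of_real (lam i)))" for z
    \<comment> \<open>Dividing by \<open>E\<close> here lets \<open>E\<close> reappear as an outer
      factor. The sum over \<open>j\<close> is the tested vector h(A) a, expanded so that
      \<open>X\<close> is visibly rational in \<open>z\<close>. For \<open>E = 0\<close> the
      quotient is 0 by convention.\<close>
    define X where "X z = D z * (\<Sum>j<n. \<alpha> j * hfun w z (d j)) / E" for z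
    define Y where "Y z = (mat_fun (hfun w z) A *\<^sub>v pert F T b w z) \<bullet>c v" for z
    have ha: "(mat_fun (hfun w z) A *\<^sub>v a) \<bullet>c v = (\<Sum>j<n. \<alpha> j * hfun w z (d j))" for z
      unfolding \<alpha>_def by (rule DA.mat_fun_mult_vec_cscalar_prod[OF a v])
    \<comment> \<open>The diagonalization and the list \<open>lam\<close> may order the eigenvalues
      of \<open>T\<close> differently; comparing characteristic polynomials makes their products
      agree.\<close>
    have char_T: "(\<Prod>i<k. z - e i) = (\<Prod>i = 1..k. z - complex_of_real (lam i))" for z
    proof -
      have "char_poly (cmat T) = map_poly complex_of_real (char_poly T)"
        by (rule of_real_hom.char_poly_hom[OF T])
      also have "\<dots> = (\<Prod>i = 1..k. [:- complex_of_real (lam i), 1:])"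
      proof -
        interpret map_poly_comm_ring_hom complex_of_real ..
        show ?thesis unfolding eigenvalues_T by (simp add: hom_prod)
      qed
      finally show ?thesis using DT.poly_char_poly[of z] by (simp add: poly_prod)
    qed
    have lam_K: "complex_of_real (lam i) \<in> K" if "i \<in> {1..k}" for i
    proof -
      have "poly (char_poly (cmat T)) (complex_of_real (lam i)) = 0"
        unfolding DT.poly_char_poly char_T using that by (auto intro!: bexI[of _ i])
      then show ?thesis by (simp add: K_def spectrum_root_char_poly[OF cT])
    qed
    have det_eq: "det (mat_fun (hfun w z) (cmat T)) = D z" for z
    proof -
      \<comment> \<open>Both differences change sign, so that numerator and denominator become
        values of the characteristic polynomial at \<open>w\<close> and at \<open>z\<close>.\<close>
      have flip: "hfun w z x = (complex_of_real w - x) / (z - x)" for x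
        unfolding hfun_def using minus_divide_divide[of "x - complex_of_real w" "x - z"] by (simp only: minus_diff_eq)
      show ?thesis
        unfolding DT.det_mat_fun D_def flip prod_dividef char_T ..
    qed
    \<comment> \<open>Valid even where the resolvent at \<open>z\<close> is unspecified: a matrix
      difference takes its dimensions from the second operand.\<close>
    have pertc: "pert F T b w z \<in> carrier_vec n" for z
    proof -
      have "resolvent (cmat T) (complex_of_real w) \<in> carrier_mat k k"
        using wK by (intro DT.resolvent_carrier) (simp add: K_def)
      then have "resolvent (cmat T) z - det (mat_fun (hfun w z) (cmat T)) \<cdot>\<^sub>m resolvent (cmat T) w
          \<in> carrier_mat k k"
        by (intro minus_carrier_mat) simp
      from mult_mat_vec_carrier[OF assms(12) mult_mat_vec_carrier[OF this e1]] T
      show ?thesis by (simp add: pert_def)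
    qed
    \<comment> \<open>The transfer identity multiplied by h(A) and tested against \<open>v\<close>;
      its left-hand side is the functional applied to 1/(x - z).\<close>
    have split: "(\<Sum>j\<in>J. c j / (m j - z)) = complex_of_real E * X z - Y z" if z: "z \<notin> K" for z
    proof -
      let ?h = "mat_fun (hfun w z) A"
      have hc: "?h \<in> carrier_mat n n" by simp
      have zA: "z \<notin> spectrum A" using z by (simp add: K_def)
      have Dac: "D z \<cdot>\<^sub>v a \<in> carrier_vec n" using a by simp
      have "W *\<^sub>v err A Q T b z = ?h *\<^sub>v (shift_mat A z *\<^sub>v err A Q T b z)"
        unfolding W_def DA.hfun_mult_shift_mat[OF zA, of "complex_of_real w", symmetric]
        by (rule assoc_mult_mat_vec[OF hc DA.shift_mat_carrier errc[OF z]])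
      also have "shift_mat A z *\<^sub>v err A Q T b z = D z \<cdot>\<^sub>v a - pert F T b w z"
        using L.shift_mat_mult_err_transfer[OF DA.diagonalized_axioms DT.diagonalized_axioms, of z "complex_of_real w"]
          z wK unfolding K_def det_eq a_def W_def by simp
      also have "?h *\<^sub>v (D z \<cdot>\<^sub>v a - pert F T b w z) = D z \<cdot>\<^sub>v (?h *\<^sub>v a) - ?h *\<^sub>v pert F T b w z"
        by (simp only: mult_minus_distrib_mat_vec[OF hc Dac pertc] mult_mat_vec[OF hc a])
      finally have "(W *\<^sub>v err A Q T b z) \<bullet>c v = (D z \<cdot>\<^sub>v (?h *\<^sub>v a) - ?h *\<^sub>v pert F T b w z) \<bullet>c v"
        by (rule arg_cong)
      also have "\<dots> = (D z \<cdot>\<^sub>v (?h *\<^sub>v a)) \<bullet>c v - Y z"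
        unfolding Y_def using mult_mat_vec_carrier[OF hc a] mult_mat_vec_carrier[OF hc pertc] v
        by (intro minus_scalar_prod_distrib[of _ n]) auto
      also have "(D z \<cdot>\<^sub>v (?h *\<^sub>v a)) \<bullet>c v = D z * ((?h *\<^sub>v a) \<bullet>c v)"
        using mult_mat_vec_carrier[OF hc a] v by (intro smult_scalar_prod_distrib[of _ n]) auto
      also have "\<dots> = complex_of_real E * X z"
      \<comment> \<open>With \<open>E = 0\<close> the vector \<open>a\<close> vanishes, so both
        sides are 0 despite the division inside \<open>X\<close>.\<close>
      proof (cases "E = 0")
        case True
        then have "a = 0\<^sub>v n" using a by (simp add: E_def vnorm2_eq_0_iff)
        then have "?h *\<^sub>v a = 0\<^sub>v n" using carrier_matD[OF hc]
          by (intro eq_vecI) (auto intro!: scalar_prod_right_zero row_carrier_vec[OF _ hc])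
        then show ?thesis using True v by simp
      qed (simp add: X_def ha)
      finally show ?thesis
        using functional[of "\<lambda>x. 1 / (x - z)"] unfolding err_eq[OF z] by simp
    qed

    \<comment> \<open>Holomorphy and pointwise bounds away from the eigenvalues\<close>
    have dK: "d j \<in> K" if "j < n" for j using DA.diag_in_spectrum[OF that] by (simp add: K_def)
    have eK: "e j \<in> K" if "j < k" for j using DT.diag_in_spectrum[OF that] by (simp add: K_def)
    \<comment> \<open>The poles of \<open>X\<close> can only lie at some \<open>d j\<close> or
      \<open>lam i\<close>, and all of these belong to \<open>K\<close>.\<close>
    have X_hol: "X holomorphic_on (N - K)"
      unfolding X_def D_def hfun_def divide_inverse[of _ "complex_of_real E"]
      using dK lam_K by (intro holomorphic_intros) auto
    have finK: "finite K" using card_finite_spectrum[OF A] card_finite_spectrum[OF cT] by (simp add: K_def)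
    have fN: "f holomorphic_on N" using assms(16) by (rule analytic_imp_holomorphic)
    have gX: "ennreal (cmod (f z * X z))
        \<le> ennreal (cmod (f z)) * (\<Prod>i = 1..k. hnorm w z (S i)) * hnorm w z (S 0)"
      if z: "z \<notin> K" for z
    proof -
      have zA: "z \<notin> spectrum A" using z by (simp add: K_def)
      obtain M where M: "M \<ge> 0" "ennreal M \<le> hnorm w z (S 0)"
        "\<And>v. v \<in> carrier_vec n \<Longrightarrow> vnorm2 (mat_fun (hfun w z) A *\<^sub>v v) \<le> M * vnorm2 v"
        using DA.hfun_operator_bound[OF n assms(24) zA] by blast
      have "cmod ((mat_fun (hfun w z) A *\<^sub>v a) \<bullet>c v) \<le> vnorm2 (mat_fun (hfun w z) A *\<^sub>v a) * vnorm2 v"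
        using a v by (intro cscalar_prod_Cauchy_Schwarz[of _ n] mult_mat_vec_carrier[OF DA.mat_fun_carrier])
      also have "\<dots> \<le> M * E" using M(3)[OF a] by (simp add: v1 E_def)
      finally have "cmod ((mat_fun (hfun w z) A *\<^sub>v a) \<bullet>c v) / E \<le> M"
        using E0 M(1) by (cases "E = 0") (auto simp: divide_le_eq)
      then have XM: "cmod (X z) \<le> cmod (D z) * M"
        unfolding X_def ha[symmetric] using E0
        by (simp add: norm_mult norm_divide mult_left_mono flip: times_divide_eq_right)
      \<comment> \<open>Each \<open>lam i\<close> lies in \<open>K\<close> and \<open>z\<close> does
        not, so every factor is evaluated away from its pole.\<close>
      have "ennreal (cmod (D z)) = (\<Prod>i = 1..k. ennreal (cmod (hfun w z (complex_of_real (lam i)))))"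
        by (simp add: D_def prod_norm[symmetric] prod_ennreal)
      also have "\<dots> \<le> (\<Prod>i = 1..k. hnorm w z (S i))"
        using lam_K z assms(25) by (intro prod_mono_ennreal hnorm_upper) auto
      finally have Dle: "ennreal (cmod (D z)) \<le> (\<Prod>i = 1..k. hnorm w z (S i))" .
      have "ennreal (cmod (f z * X z)) \<le> ennreal (cmod (f z) * (cmod (D z) * M))"
        using XM by (intro ennreal_leI) (simp add: norm_mult mult_left_mono)
      also have "\<dots> = ennreal (cmod (f z)) * (ennreal (cmod (D z)) * ennreal M)"
        using M(1) by (simp add: ennreal_mult)
      also have "\<dots> \<le> ennreal (cmod (f z)) * ((\<Prod>i = 1..k. hnorm w z (S i)) * hnorm w z (S 0))"
        by (intro mult_mono order_refl Dle M(2)) auto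
      finally show ?thesis by (simp only: mult.assoc)
    qed
    have gY: "ennreal (cmod (f z * Y z))
        \<le> ennreal (cmod (f z)) * hnorm w z (S 0) * ennreal (vnorm2 (pert F T b w z))"
      if z: "z \<notin> K" for z
    proof -
      have zA: "z \<notin> spectrum A" using z by (simp add: K_def)
      obtain M where M: "M \<ge> 0" "ennreal M \<le> hnorm w z (S 0)"
        "\<And>v. v \<in> carrier_vec n \<Longrightarrow> vnorm2 (mat_fun (hfun w z) A *\<^sub>v v) \<le> M * vnorm2 v"
        using DA.hfun_operator_bound[OF n assms(24) zA] by blast
      let ?p = "pert F T b w z"
      have "cmod (Y z) \<le> vnorm2 (mat_fun (hfun w z) A *\<^sub>v ?p) * vnorm2 v"
        unfolding Y_def
        using pertc v by (intro cscalar_prod_Cauchy_Schwarz[of _ n] mult_mat_vec_carrier[OF DA.mat_fun_carrier])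
      also have "\<dots> \<le> M * vnorm2 ?p" using M(3)[OF pertc] by (simp add: v1)
      finally have "ennreal (cmod (f z * Y z)) \<le> ennreal (cmod (f z) * (M * vnorm2 ?p))"
        by (intro ennreal_leI) (simp add: norm_mult mult_left_mono)
      also have "\<dots> = ennreal (cmod (f z)) * (ennreal M * ennreal (vnorm2 ?p))"
        using M(1) vnorm2_nonneg[OF pertc] by (simp add: ennreal_mult)
      also have "\<dots> \<le> ennreal (cmod (f z)) * (hnorm w z (S 0) * ennreal (vnorm2 ?p))"
        by (intro mult_mono order_refl M(2)) auto
      finally show ?thesis by (simp only: mult.assoc)
    qed
    have "vnorm2 u = cmod (u \<bullet>c v)" unfolding uv using up by simp
    also have "u \<bullet>c v = (\<Sum>j\<in>J. c j * f (m j))" unfolding u_def by (rule functional)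
    finally have u_sum: "vnorm2 u = cmod (\<Sum>j\<in>J. c j * f (m j))" .
    have path: "z \<notin> K" if "\<gamma> \<in> \<Gamma>" "z \<in> path_image \<gamma>" for \<gamma> z
      using avoids[OF that(1)] that(2) unfolding K_def by blast
    show ?thesis
      unfolding nrm_u nrm_err u_sum
    proof (rule Cauchy_integral_estimate[OF assms(14) fN assms(17) curves curves_in_N avoids encloses, folded K_def])
      show "finite J" by (simp add: J_def)
      show "m j \<in> K" if "j \<in> J" for j using that dK eK by (auto simp: J_def m_def)
    qed (use assms(15) K_def finK X_hol E0 split path gX gY in auto)
  qed
qed

end
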